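(* Let $N\ge 2$ be an integer, let $\chi$ be a non-principal Dirichlet character modulo $N$, $\tau\in\mathbb{H}$ and $z\in\mathbb{C}$. Then $$h_N(z;\tau,\chi)-h_N(z+\sqrt N;\tau,\chi)=-\frac{\chi(-1)}{\sqrt{-i\tau}}\sum_{k=1}^{N-1}\chi(k)\,e^{i\pi(z+\frac{k}{\sqrt N})^2/\tau}.$$ If moreover $N\ge 3$ and $\chi$ is primitive modulo $N$, then $$h_N(z;\tau,\chi)-e^{-i\pi N\tau-2i\pi\sqrt N z}\,h_N(z+\sqrt N\tau;\tau,\chi)=\frac{g(\chi)}{i\sqrt N}\sum_{n=1}^{N-1}\overline{\chi(n)}\,e^{-i\pi n^2\tau/N-2i\pi nz/\sqrt N}.$$
   Context: A Dirichlet character modulo $N$ is a function $\chi:\mathbb{Z}\to\mathbb{C}$ with $\chi(1)=1$, $\chi(n+N)=\chi(n)$, $\chi(mn)=\chi(m)\chi(n)$, and $\chi(n)=0$ iff $\gcd(n,N)>1$; it is principal if $\chi(n)=1$ whenever $\gcd(n,N)=1$, and primitive if it is not induced by a character modulo a proper divisor of $N$. $\mathbb{H}$ is the upper half-plane. Define $\phi_N(t;\chi)=\frac{\sum_{n=1}^{N-1}\chi(n)t^n}{1-t^N}$, $\Phi_N(x;\chi)=\phi_N(e^{2\pi x/\sqrt N};\chi)$ (removable singularity at $x=0$), and $h_N(z;\tau,\chi)=\int_{-\infty}^{\infty}\Phi_N(x;\chi)e^{\pi i\tau x^2-2\pi zx}dx$. The Gauss sum is $g(\chi)=\sum_{k=1}^{N-1}\chi(k)e^{2\pi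 ik/N}$. $\sqrt{-i\tau}$ denotes the principal branch (positive real part). *)

theory Defs
  imports "HOL-Complex_Analysis.Complex_Analysis"
begin

definition dirichlet_character :: "nat \<Rightarrow> (int \<Rightarrow> complex) \<Rightarrow> bool" where
  "dirichlet_character N chi \<longleftrightarrow>
     chi 1 = 1 \<and>
     (\<forall>n. chi (n + int N) = chi n) \<and>
     (\<forall>m n. chi (m * n) = chi m * chi n) \<and>
     (\<forall>n. chi n = 0 \<longleftrightarrow> gcd n (int N) > 1)"

definition principal_character :: "nat \<Rightarrow> (int \<Rightarrow> complex) \<Rightarrow> bool" where
  "principal_character N chi \<longleftrightarrow> (\<forall>n. gcd n (int N) = 1 \<longrightarrow> chi n = 1)"

definition induced_by :: "nat \<Rightarrow> (int \<Rightarrow> complex) \<Rightarrow> nat \<Rightarrow> (int \<Rightarrow> complex) \<Rightarrow> bool" where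
  "induced_by N chi d psi \<longleftrightarrow>
     d dvd N \<and> dirichlet_character d psi \<and> (\<forall>n. gcd n (int N) = 1 \<longrightarrow> chi n = psi n)"

definition primitive_character :: "nat \<Rightarrow> (int \<Rightarrow> complex) \<Rightarrow> bool" where
  "primitive_character N chi \<longleftrightarrow>
     dirichlet_character N chi \<and> \<not> (\<exists>d psi. d \<noteq> N \<and> induced_by N chi d psi)"

definition phi_N :: "nat \<Rightarrow> (int \<Rightarrow> complex) \<Rightarrow> complex \<Rightarrow> complex" where
  "phi_N N chi t = (\<Sum>n=1..N-1. chi (int n) * t ^ n) / (1 - t ^ N)"

(* For non-principal chi the numerator of phi_N vanishes at t = 1, so the singularity at x = 0 is
   removable; remove_sings assigns the limit there. It is the only singularity on the real axis. *)
definition Phi_N :: "nat \<Rightarrow> (int \<Rightarrow> complex) \<Rightarrow> complex \<Rightarrow> complex" where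
  "Phi_N N chi = remove_sings (\<lambda>x. phi_N N chi (exp (2 * of_real pi * x / of_real (sqrt (real N)))))"

definition h_N :: "nat \<Rightarrow> complex \<Rightarrow> complex \<Rightarrow> (int \<Rightarrow> complex) \<Rightarrow> complex" where
  "h_N N z \<tau> chi =
     (LINT x|lborel. Phi_N N chi (of_real x) *
        exp (of_real pi * \<i> * \<tau> * (of_real x)\<^sup>2 - 2 * of_real pi * z * of_real x))"

definition gauss_sum :: "nat \<Rightarrow> (int \<Rightarrow> complex) \<Rightarrow> complex" where
  "gauss_sum N chi =
     (\<Sum>k=1..N-1. chi (int k) * exp (2 * of_real pi * \<i> * of_nat k / of_nat N))"

end

theory Submission
  imports Defs "HOL-Probability.Distributions" "HOL-Real_Asymp.Real_Asymp" "HOL-Number_Theory.Number_Theory"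
begin

text \<open>
  Write \<open>s = sqrt N\<close>. Translating \<open>z\<close> by \<open>s\<close> multiplies the integrand by \<open>exp (-2 pi s x)\<close>, and
  \<open>1 - exp (-2 pi s x)\<close> cancels the denominator of \<open>\<Phi>\<close>; what remains is a sum of Gaussian
  integrals. Translating \<open>z\<close> by \<open>s \<tau>\<close> amounts, up to the exponential factor, to moving the
  line of integration from the real axis to \<open>Im x = s\<close>, because \<open>\<Phi>\<close> has period \<open>\<i> s\<close>. The difference
  is the sum of the residues at \<open>\<i> k / s\<close> with \<open>0 < k < N\<close> (the singularities at \<open>0\<close> and \<open>\<i> s\<close> are
  removable), and primitivity of \<open>\<chi>\<close> evaluates these as twisted Gauss sums.
\<close>

section \<open>Gaussian integrals\<close>

text \<open>The denominator \<open>1 - exp (2 pi s x)\<close> has only simple zeros, the points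
  \<open>\<i> k / s\<close>, and two of them lie on the lines of integration. Non-principality
  enters through one fact, \<open>chi 1 + ... + chi (N-1) = 0\<close>: it makes the numerator vanish
  at \<open>0\<close> and, by periodicity, at \<open>\<i> s\<close>. At the other zeros the
  numerator is a Gauss sum twisted by \<open>k\<close>. For \<open>k\<close> coprime to
  \<open>N\<close> a substitution evaluates it. The obstacle is \<open>gcd k N > 1\<close>, where it
  has to vanish: a nonzero value would make \<open>chi\<close> trivial on the units congruent to 1
  modulo \<open>N / gcd k N\<close>, and from this an inducing character of smaller modulus must be
  constructed. The root \<open>csqrt (- \<i> * \<tau>)\<close> is the direction of a tilted line:
  completing the square turns the real Gaussian integral into one along that line, which is then
  rotated back to the real axis. The factor \<open>chi (-1)\<close> comes from the cancellation
  producing the shifts \<open>(N - n) / s\<close> instead of \<open>n / s\<close>.\<close>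

lemma integrable_exp_neg_square:
  fixes d :: real
  assumes "d > 0"
  shows "integrable lborel (\<lambda>x. exp (- d * x\<^sup>2))"
proof -
  \<comment> \<open>Chosen so that \<open>1 / (2 * \<sigma>\<^sup>2) = d\<close>; the function is
    then a multiple of a normal density.\<close>
  define \<sigma> where "\<sigma> = 1 / sqrt (2 * d)"
  have "\<sigma> > 0" and \<sigma>2: "\<sigma>\<^sup>2 = 1 / (2 * d)"
    using assms by (auto simp: \<sigma>_def power_divide)
  have "integrable lborel (\<lambda>x. sqrt (2 * pi * \<sigma>\<^sup>2) * normal_density 0 \<sigma> x)"
    using \<open>\<sigma> > 0\<close> by (intro integrable_mult_right integrable_normal_density)
  also have "(\<lambda>x. sqrt (2 * pi * \<sigma>\<^sup>2) * normal_density 0 \<sigma> x) = (\<lambda>x. exp (- d * x\<^sup>2))"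
    using assms \<open>\<sigma> > 0\<close> by (auto simp: normal_density_def \<sigma>2 fun_eq_iff field_simps)
  finally show ?thesis .
qed

text \<open>On a strip of bounded height the real part of the exponent is
  \<open>- Re a * (Re x)\<^sup>2\<close> plus terms at most linear in \<open>Re x\<close>; half of
  the quadratic decay absorbs them. Height 0 yields integrability on the real axis, height
  \<open>sqrt N\<close> the decay on vertical edges.\<close>

lemma norm_exp_quadratic_strip_bound:
  fixes a b :: complex and Y :: real
  assumes "Re a > 0"
  obtains K d where "K \<ge> 0" "d > 0"
    "\<And>x. 0 \<le> Im x \<Longrightarrow> Im x \<le> Y \<Longrightarrow> norm (exp (- a * x\<^sup>2 + b * x)) \<le> K * exp (- d * (Re x)\<^sup>2)"
proof -
  define d where "d = Re a / 2"
  \<comment> \<open>\<open>A\<close> bounds the coefficient of \<open>Re x\<close> in the exponent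
    over the whole strip, \<open>B\<close> the part free of \<open>Re x\<close>.\<close>
  define A where "A = 2 * \<bar>Im a\<bar> * Y + \<bar>Re b\<bar>"
  define B where "B = Re a * Y\<^sup>2 + \<bar>Im b\<bar> * Y"
  have "d > 0" using assms by (simp add: d_def)
  have "norm (exp (- a * x\<^sup>2 + b * x)) \<le> exp (B + A\<^sup>2 / (4 * d)) * exp (- d * (Re x)\<^sup>2)"
    if y: "0 \<le> Im x" "Im x \<le> Y" for x
  proof -
    define u v where "u = Re x" and "v = Im x"
    have v: "0 \<le> v" "v \<le> Y" using y by (auto simp: v_def)
    have "Re (- a * x\<^sup>2 + b * x) = - (2 * d) * u\<^sup>2 + Re a * v\<^sup>2 + (2 * Im a * v + Re b) * u - Im b * v"
      by (simp add: u_def v_def power2_eq_square algebra_simps d_def)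
    also have "\<dots> \<le> - (2 * d) * u\<^sup>2 + Re a * Y\<^sup>2 + A * \<bar>u\<bar> + \<bar>Im b\<bar> * Y"
    proof -
      have 1: "Re a * v\<^sup>2 \<le> Re a * Y\<^sup>2"
        using v assms by (intro mult_left_mono power_mono) auto
      have "\<bar>2 * Im a * v + Re b\<bar> \<le> \<bar>2 * Im a * v\<bar> + \<bar>Re b\<bar>" by (rule abs_triangle_ineq)
      also have "\<dots> \<le> A"
        using v by (auto simp: A_def abs_mult intro!: mult_left_mono)
      finally have "\<bar>2 * Im a * v + Re b\<bar> * \<bar>u\<bar> \<le> A * \<bar>u\<bar>" by (intro mult_right_mono) auto
      then have 2: "(2 * Im a * v + Re b) * u \<le> A * \<bar>u\<bar>"
        using abs_ge_self[of "(2 * Im a * v + Re b) * u"] by (simp add: abs_mult)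
      have "- (Im b * v) \<le> \<bar>Im b\<bar> * v" using abs_ge_minus_self[of "Im b * v"] v by (simp add: abs_mult)
      also have "\<dots> \<le> \<bar>Im b\<bar> * Y" using v by (intro mult_left_mono) auto
      finally show ?thesis using 1 2 by linarith
    qed
    also have "\<dots> \<le> B + A\<^sup>2 / (4 * d) - d * u\<^sup>2"
    proof -
      \<comment> \<open>Completing the square trades \<open>A * \<bar>u\<bar>\<close> for
        \<open>d * u\<^sup>2\<close> and the constant \<open>A\<^sup>2 / (4 * d)\<close>.\<close>
      have "0 \<le> d * (\<bar>u\<bar> - A / (2 * d))\<^sup>2" using \<open>d > 0\<close> by simp
      also have "\<dots> = d * u\<^sup>2 - A * \<bar>u\<bar> + A\<^sup>2 / (4 * d)"
        using \<open>d > 0\<close> by (simp add: power2_eq_square field_simps)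
      finally show ?thesis by (simp add: B_def)
    qed
    finally show ?thesis
      by (simp add: u_def exp_add[symmetric] add.commute)
  qed
  with \<open>d > 0\<close> show ?thesis by (intro that[of "exp (B + A\<^sup>2 / (4 * d))" d]) auto
qed

lemma exp_neg_square_tendsto_0:
  fixes d :: real
  assumes "d > 0"
  shows "((\<lambda>x. K * exp (- d * x\<^sup>2)) \<longlongrightarrow> 0) at_top"
  using assms by real_asymp

lemma integrable_exp_quadratic:
  fixes a b :: complex
  assumes "Re a > 0"
  shows "integrable lborel (\<lambda>x. exp (- a * (of_real x)\<^sup>2 + b * of_real x))"
proof -
  obtain K d where Kd: "K \<ge> 0" "d > 0"
    "\<And>x. 0 \<le> Im x \<Longrightarrow> Im x \<le> 0 \<Longrightarrow> norm (exp (- a * x\<^sup>2 + b * x)) \<le> K * exp (- d * (Re x)\<^sup>2)"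
    using norm_exp_quadratic_strip_bound[OF assms, of 0 b] by blast
  show ?thesis
  proof (rule Bochner_Integration.integrable_bound)
    show "integrable lborel (\<lambda>x. K * exp (- d * x\<^sup>2))"
      using integrable_exp_neg_square[OF Kd(2)] by (intro integrable_mult_right)
    show "(\<lambda>x. exp (- a * (of_real x)\<^sup>2 + b * of_real x)) \<in> borel_measurable lborel"
      unfolding measurable_lborel2 by (intro borel_measurable_continuous_onI continuous_intros)
    show "AE x in lborel. norm (exp (- a * (of_real x)\<^sup>2 + b * of_real x)) \<le> norm (K * exp (- d * x\<^sup>2))"
    proof (rule AE_I2)
      fix x :: real
      show "norm (exp (- a * (of_real x)\<^sup>2 + b * of_real x)) \<le> norm (K * exp (- d * x\<^sup>2))"
        using Kd(3)[of "of_real x"] Kd(1) by simp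
    qed
  qed
qed

text \<open>On the segment from \<open>R\<close> to \<open>c R + s\<close> one has \<open>Re (z\<^sup>2) \<ge> (Re z - \<bar>Im z\<bar>)\<^sup>2\<close>, which grows quadratically in \<open>R\<close>.\<close>
lemma primitive_gaussian_diff_tendsto_0:
  fixes P :: "complex \<Rightarrow> complex" and c s :: complex
  assumes P: "\<And>z. (P has_field_derivative exp (- of_real pi * z\<^sup>2)) (at z)"
    and c: "Re c > \<bar>Im c\<bar>"
  shows "((\<lambda>R. P (c * of_real R + s) - P (of_real R)) \<longlongrightarrow> 0) at_top"
proof -
  \<comment> \<open>Along the segment the coefficient of \<open>R\<close> in the lower bound for
    \<open>Re z - \<bar>Im z\<bar>\<close> is a convex combination of 1 and
    \<open>Re c - \<bar>Im c\<bar>\<close>, hence at least \<open>\<delta>\<close>; \<open>m\<close>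
    absorbs the contribution of \<open>s\<close>.\<close>
  define \<delta> where "\<delta> = min 1 (Re c - \<bar>Im c\<bar>)"
  define m where "m = \<bar>Re s\<bar> + \<bar>Im s\<bar>"
  have "\<delta> > 0" using c by (simp add: \<delta>_def)
  have "m \<ge> 0" by (simp add: m_def)
  have bound: "norm (P (c * of_real R + s) - P (of_real R))
      \<le> exp (- pi * (\<delta> * R - m)\<^sup>2) * (norm (c - 1) * R + norm s)"
    if R: "R > 0" "\<delta> * R > m" for R
  proof -
    \<comment> \<open>Mean value inequality on the segment: its length grows linearly in
      \<open>R\<close>, while the derivative of \<open>P\<close> on it is at most a Gaussian in
      \<open>R\<close>.\<close>
    have "norm (P (c * of_real R + s) - P (of_real R))
      \<le> exp (- pi * (\<delta> * R - m)\<^sup>2) * norm (c * of_real R + s - of_real R)"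
    proof (rule field_differentiable_bound[where f = P and S = "closed_segment (of_real R) (c * of_real R + s)"])
      fix z assume "z \<in> closed_segment (of_real R) (c * of_real R + s)"
      then obtain u where u: "0 \<le> u" "u \<le> 1" "z = (1 - u) *\<^sub>R of_real R + u *\<^sub>R (c * of_real R + s)"
        by (auto simp: closed_segment_def)
      have re: "Re z = R * ((1 - u) + u * Re c) + u * Re s"
        and im: "Im z = R * (u * Im c) + u * Im s"
        by (simp_all add: u(3) algebra_simps)
      have a: "u * \<bar>Re s\<bar> \<le> \<bar>Re s\<bar>" "u * \<bar>Im s\<bar> \<le> \<bar>Im s\<bar>"
        using u by (simp_all add: mult_left_le_one_le)
      have r: "Re z \<ge> R * ((1 - u) + u * Re c) - \<bar>Re s\<bar>"
      proof -
        have "- (u * Re s) \<le> \<bar>Re s\<bar>"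
          using a(1) u abs_ge_minus_self[of "u * Re s"] by (simp add: abs_mult)
        then show ?thesis unfolding re by linarith
      qed
      have "\<bar>Im z\<bar> \<le> \<bar>R * (u * Im c)\<bar> + \<bar>u * Im s\<bar>" unfolding im by (rule abs_triangle_ineq)
      also have "\<dots> \<le> R * (u * \<bar>Im c\<bar>) + \<bar>Im s\<bar>" using u R a by (simp add: abs_mult)
      finally have i: "\<bar>Im z\<bar> \<le> R * (u * \<bar>Im c\<bar>) + \<bar>Im s\<bar>" .
      have "\<delta> = (1 - u) * \<delta> + u * \<delta>" by (simp add: algebra_simps)
      also have "\<dots> \<le> (1 - u) * 1 + u * (Re c - \<bar>Im c\<bar>)"
        using u by (intro add_mono mult_left_mono) (auto simp: \<delta>_def)
      finally have "R * \<delta> \<le> R * ((1 - u) + u * (Re c - \<bar>Im c\<bar>))"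
        using R by (intro mult_left_mono) auto
      with r i have lower: "\<delta> * R - m \<le> Re z - \<bar>Im z\<bar>"
        by (simp add: m_def algebra_simps)
      have "(\<delta> * R - m)\<^sup>2 \<le> (\<delta> * R - m) * (\<delta> * R - m)" by (simp add: power2_eq_square)
      \<comment> \<open>Both factors are at least \<open>\<delta> * R - m\<close>, which is
        positive, and their product is the real part of \<open>z\<^sup>2\<close>.\<close>
      also have "\<dots> \<le> (Re z - \<bar>Im z\<bar>) * (Re z + \<bar>Im z\<bar>)"
        using lower R by (intro mult_mono) auto
      also have "\<dots> = (Re z)\<^sup>2 - (Im z)\<^sup>2" by (simp add: algebra_simps power2_eq_square)
      finally show "norm (exp (- of_real pi * z\<^sup>2)) \<le> exp (- pi * (\<delta> * R - m)\<^sup>2)"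
        by (simp add: power2_eq_square)
    qed (use P in \<open>auto intro: has_field_derivative_at_within\<close>)
    also have "\<dots> \<le> exp (- pi * (\<delta> * R - m)\<^sup>2) * (norm (c - 1) * R + norm s)"
    proof (intro mult_left_mono)
      have "norm (c * of_real R + s - of_real R) = norm ((c - 1) * of_real R + s)"
        by (simp add: algebra_simps)
      also have "\<dots> \<le> norm ((c - 1) * of_real R) + norm s" by (rule norm_triangle_ineq)
      finally show "norm (c * of_real R + s - of_real R) \<le> norm (c - 1) * R + norm s"
        using R by (simp add: norm_mult)
    qed auto
    finally show ?thesis .
  qed
  have ev: "\<forall>\<^sub>F R in at_top. norm (P (c * of_real R + s) - P (of_real R))
      \<le> exp (- pi * (\<delta> * R - m)\<^sup>2) * (norm (c - 1) * R + norm s)"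
    using eventually_gt_at_top[of 0] eventually_gt_at_top[of "m / \<delta>"]
  proof eventually_elim
    case (elim R)
    then show ?case using \<open>\<delta> > 0\<close> by (intro bound) (auto simp: field_simps)
  qed
  have "((\<lambda>R. exp (- pi * (\<delta> * R - m)\<^sup>2) * (norm (c - 1) * R + norm s)) \<longlongrightarrow> 0) at_top"
    using \<open>\<delta> > 0\<close> pi_gt_zero by real_asymp
  from Lim_null_comparison[OF ev this] show ?thesis .
qed

lemma real_gaussian_integral: "(LINT x|lborel. exp (- pi * x\<^sup>2)) = (1::real)"
proof -
  have "(LINT x|lborel. normal_density 0 (1 / sqrt (2 * pi)) x) = 1"
    by (rule integral_normal_density) simp
  also have "normal_density 0 (1 / sqrt (2 * pi)) = (\<lambda>x. exp (- pi * x\<^sup>2))"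
  proof
    fix x :: real
    have "(1 / sqrt (2 * pi))\<^sup>2 = 1 / (2 * pi)" by (simp add: power_divide)
    then show "normal_density 0 (1 / sqrt (2 * pi)) x = exp (- pi * x\<^sup>2)"
      unfolding normal_density_def by (simp add: mult.commute)
  qed
  finally show ?thesis .
qed

text \<open>Dominated convergence. This is the bridge between Lebesgue integrals over the line and
  the gauge integrals over \<open>{-R..R}\<close> on which primitives and contour integrals
  operate.\<close>

lemma tendsto_integral_symmetric_interval:
  fixes f :: "real \<Rightarrow> complex"
  assumes f: "integrable lborel f"
  shows "((\<lambda>R. integral {-R..R} f) \<longlongrightarrow> (LINT x|lborel. f x)) at_top"
proof -
  have "((\<lambda>R. LINT x|lborel. indicator {-R..R} x *\<^sub>R f x) \<longlongrightarrow> (LINT x|lborel. f x)) at_top"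
  proof (rule integral_dominated_convergence_at_top[where w = "\<lambda>x. norm (f x)"
        and s = "\<lambda>R x. indicator {-R..R} x *\<^sub>R f x" and f = f and M = lborel])
    show "f \<in> borel_measurable lborel" using f by (rule borel_measurable_integrable)
    then show "(\<lambda>x. indicator {-R..R} x *\<^sub>R f x) \<in> borel_measurable lborel" for R
      by simp
    show "integrable lborel (\<lambda>x. norm (f x))" using f by (rule integrable_norm)
    show "AE x in lborel. ((\<lambda>R. indicator {-R..R} x *\<^sub>R f x) \<longlongrightarrow> f x) at_top"
    proof (rule AE_I2, rule tendsto_eventually)
      fix x :: real
      show "\<forall>\<^sub>F R in at_top. indicator {-R..R} x *\<^sub>R f x = f x"
        using eventually_ge_at_top[of "\<bar>x\<bar>"] by eventually_elim (auto simp: indicator_def)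
    qed
    show "\<forall>\<^sub>F R in at_top. AE x in lborel. norm (indicator {-R..R} x *\<^sub>R f x) \<le> norm (f x)"
      by (intro always_eventually allI AE_I2) (auto simp: indicator_def)
  qed
  moreover have "(LINT x|lborel. indicator {-R..R} x *\<^sub>R f x) = integral {-R..R} f" for R :: real
  proof -
    have "set_integrable lborel {-R..R} f"
      unfolding set_integrable_def using f by (intro integrable_mult_indicator) simp_all
    from set_borel_integral_eq_integral(2)[OF this] show ?thesis
      by (simp add: set_lebesgue_integral_def)
  qed
  ultimately show ?thesis by simp
qed

text \<open>\<open>c\<close> times the integral is the Gaussian integral along the line through
  \<open>s\<close> in direction \<open>c\<close>. In the sector
  \<open>Re c > \<bar>Im c\<bar>\<close> the ends of this line can be joined to those of the real
  axis at vanishing cost, so the value is that of the real Gaussian, namely 1.\<close>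

lemma gaussian_line_integral:
  fixes c s :: complex
  assumes c: "Re c > \<bar>Im c\<bar>"
  shows "integrable lborel (\<lambda>x. exp (- of_real pi * (c * of_real x + s)\<^sup>2))"
    and "(LINT x|lborel. exp (- of_real pi * (c * of_real x + s)\<^sup>2)) = 1 / c"
proof -
  \<comment> \<open>Kept general in \<open>c\<close> and \<open>s\<close>, since it also serves the
    reference case \<open>c = 1\<close>, \<open>s = 0\<close>.\<close>
  have int: "integrable lborel (\<lambda>x. exp (- of_real pi * (c * of_real x + s)\<^sup>2))"
    if c: "Re c > \<bar>Im c\<bar>" for c s :: complex
  proof -
    have "\<bar>Im c\<bar> * \<bar>Im c\<bar> < Re c * Re c" using c by (intro mult_strict_mono) auto
    then have "Re (of_real pi * c\<^sup>2) > 0" by (simp add: power2_eq_square)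
    from integrable_exp_quadratic[OF this, of "- 2 * of_real pi * c * s"]
    have "integrable lborel (\<lambda>x. exp (- of_real pi * s\<^sup>2) *
        exp (- (of_real pi * c\<^sup>2) * (of_real x)\<^sup>2 + - 2 * of_real pi * c * s * of_real x))"
      by (rule integrable_mult_right)
    also have "(\<lambda>x. exp (- of_real pi * s\<^sup>2) *
        exp (- (of_real pi * c\<^sup>2) * (of_real x)\<^sup>2 + - 2 * of_real pi * c * s * of_real x))
        = (\<lambda>x. exp (- of_real pi * (c * of_real x + s)\<^sup>2))"
      unfolding exp_add[symmetric] by (simp add: power2_eq_square algebra_simps)
    finally show ?thesis .
  qed
  show "integrable lborel (\<lambda>x. exp (- of_real pi * (c * of_real x + s)\<^sup>2))"
    using int[OF c] .
  have hol: "(\<lambda>z. exp (- of_real pi * z\<^sup>2)) holomorphic_on (UNIV :: complex set)"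
    by (intro holomorphic_intros)
  have "\<exists>P. \<forall>z::complex. (P has_field_derivative exp (- of_real pi * z\<^sup>2)) (at z)"
    by (rule holomorphic_convex_primitive'[OF convex_UNIV open_UNIV hol]) auto
  then obtain P :: "complex \<Rightarrow> complex" where P: "(P has_field_derivative exp (- of_real pi * z\<^sup>2)) (at z)" for z
    by blast
  \<comment> \<open>\<open>Q\<close> is another primitive of the same even function. Applied to
    \<open>Q\<close> and \<open>- s\<close>, the estimate for the right ends compares the left ends
    \<open>- c * R + s\<close> and \<open>- R\<close>.\<close>
  define Q where "Q = (\<lambda>z. - P (- z))"
  have Q: "(Q has_field_derivative exp (- of_real pi * z\<^sup>2)) (at z)" for z
  proof -
    have "((\<lambda>z. P (- z)) has_field_derivative exp (- of_real pi * (- z)\<^sup>2) * (- 1)) (at z)"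
      by (rule DERIV_chain2[OF P]) (auto intro!: derivative_eq_intros)
    from DERIV_minus[OF this] show ?thesis by (simp add: Q_def)
  qed
  have lim: "((\<lambda>R. P (c * of_real R + s) - P (c * of_real (- R) + s)) \<longlongrightarrow>
      c * (LINT x|lborel. exp (- of_real pi * (c * of_real x + s)\<^sup>2))) at_top"
    if c: "Re c > \<bar>Im c\<bar>" for c s
  proof (rule Lim_transform_eventually)
    show "((\<lambda>R. c * integral {-R..R} (\<lambda>x. exp (- of_real pi * (c * of_real x + s)\<^sup>2))) \<longlongrightarrow>
      c * (LINT x|lborel. exp (- of_real pi * (c * of_real x + s)\<^sup>2))) at_top"
      by (intro tendsto_mult tendsto_const tendsto_integral_symmetric_interval int c)
    show "\<forall>\<^sub>F R in at_top. c * integral {-R..R} (\<lambda>x. exp (- of_real pi * (c * of_real x + s)\<^sup>2))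
        = P (c * of_real R + s) - P (c * of_real (- R) + s)"
      using eventually_ge_at_top[of 0]
    proof eventually_elim
      case (elim R)
      have "((\<lambda>x. c * exp (- of_real pi * (c * of_real x + s)\<^sup>2)) has_integral
          P (c * of_real R + s) - P (c * of_real (- R) + s)) {-R..R}"
      proof (rule fundamental_theorem_of_calculus)
        show "((\<lambda>x. P (c * of_real x + s)) has_vector_derivative
            c * exp (- of_real pi * (c * of_real x + s)\<^sup>2)) (at x within {-R..R})" for x
        proof -
          have "((\<lambda>w. P (c * w + s)) has_field_derivative
              exp (- of_real pi * (c * of_real x + s)\<^sup>2) * c) (at (of_real x))"
            by (rule DERIV_chain2[OF P]) (auto intro!: derivative_eq_intros)
          from has_vector_derivative_real_field[OF this] show ?thesis by (simp add: mult.commute)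
        qed
      qed (use elim in auto)
      from integral_unique[OF this] show ?case by simp
    qed
  qed
  have "((\<lambda>R. P (of_real R) - P (of_real (- R))) \<longlongrightarrow> 1) at_top"
  proof -
    have "(LINT x|lborel. exp (- of_real pi * (of_real x)\<^sup>2) :: complex)
        = of_real (LINT x|lborel. exp (- pi * x\<^sup>2))"
      unfolding integral_complex_of_real[symmetric] by (simp add: exp_of_real[symmetric])
    with lim[of 1 0] show ?thesis using real_gaussian_integral by simp
  qed
  moreover have "((\<lambda>R. P (c * of_real R + s) - P (of_real R)) \<longlongrightarrow> 0) at_top"
    by (rule primitive_gaussian_diff_tendsto_0[OF P c])
  moreover have "((\<lambda>R. Q (c * of_real R + (- s)) - Q (of_real R)) \<longlongrightarrow> 0) at_top"
    by (rule primitive_gaussian_diff_tendsto_0[OF Q c])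
  ultimately have "((\<lambda>R. (P (of_real R) - P (of_real (- R))) + (P (c * of_real R + s) - P (of_real R))
      + (Q (c * of_real R + (- s)) - Q (of_real R))) \<longlongrightarrow> 1 + 0 + 0) at_top"
    by (intro tendsto_add)
  then have "((\<lambda>R. P (c * of_real R + s) - P (c * of_real (- R) + s)) \<longlongrightarrow> 1) at_top"
    by (simp add: Q_def algebra_simps)
  from tendsto_unique[OF _ lim[OF c] this]
  have "c * (LINT x|lborel. exp (- of_real pi * (c * of_real x + s)\<^sup>2)) = 1" by simp
  moreover have "c \<noteq> 0" using c by auto
  ultimately show "(LINT x|lborel. exp (- of_real pi * (c * of_real x + s)\<^sup>2)) = 1 / c"
    by (simp add: field_simps)
qed

text \<open>Complete the square with \<open>c = csqrt (- \<i> * \<tau>)\<close>, which turns the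
  exponent into \<open>- pi * (c * x + w / c)\<^sup>2\<close> plus a constant.\<close>

lemma gaussian_integral_upper_half_plane:
  fixes \<tau> w :: complex
  assumes "Im \<tau> > 0"
  shows "integrable lborel (\<lambda>x. exp (of_real pi * \<i> * \<tau> * (of_real x)\<^sup>2 - 2 * of_real pi * w * of_real x))"
    and "(LINT x|lborel. exp (of_real pi * \<i> * \<tau> * (of_real x)\<^sup>2 - 2 * of_real pi * w * of_real x))
      = exp (\<i> * of_real pi * w\<^sup>2 / \<tau>) / csqrt (- \<i> * \<tau>)"
proof -
  define c where "c = csqrt (- \<i> * \<tau>)"
  have c2: "c\<^sup>2 = - \<i> * \<tau>" unfolding c_def by (rule power2_csqrt)
  have "\<tau> \<noteq> 0" using assms by auto
  then have "c \<noteq> 0" by (auto simp: c_def)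
  have "Re c \<ge> 0" unfolding c_def by (rule Re_csqrt)
  \<comment> \<open>Positivity of \<open>Re (c\<^sup>2) = Im \<tau>\<close> together with
    \<open>Re c \<ge> 0\<close> from the principal branch places \<open>c\<close> in the required
    sector.\<close>
  have "Re (c\<^sup>2) > 0" unfolding c2 using assms by simp
  then have "\<bar>Im c\<bar>\<^sup>2 < (Re c)\<^sup>2" by (simp add: power2_eq_square)
  then have c: "Re c > \<bar>Im c\<bar>" using \<open>Re c \<ge> 0\<close> by (rule power_less_imp_less_base)
  have eq: "exp (of_real pi * \<i> * \<tau> * (of_real x)\<^sup>2 - 2 * of_real pi * w * of_real x)
      = exp (\<i> * of_real pi * w\<^sup>2 / \<tau>) * exp (- of_real pi * (c * of_real x + w / c)\<^sup>2)" for x :: real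
  proof -
    have "(c * of_real x + w / c)\<^sup>2 = c\<^sup>2 * (of_real x)\<^sup>2 + 2 * w * of_real x + w\<^sup>2 / c\<^sup>2"
      using \<open>c \<noteq> 0\<close> by (simp add: power2_eq_square field_simps)
    also have "w\<^sup>2 / c\<^sup>2 = \<i> * w\<^sup>2 / \<tau>"
      unfolding c2 using \<open>\<tau> \<noteq> 0\<close> by (simp add: field_simps)
    finally have sq: "(c * of_real x + w / c)\<^sup>2
        = - \<i> * \<tau> * (of_real x)\<^sup>2 + 2 * w * of_real x + \<i> * w\<^sup>2 / \<tau>"
      unfolding c2 .
    show ?thesis
      unfolding exp_add[symmetric] sq by (simp add: algebra_simps)
  qed
  show "integrable lborel (\<lambda>x. exp (of_real pi * \<i> * \<tau> * (of_real x)\<^sup>2 - 2 * of_real pi * w * of_real x))"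
    unfolding eq by (intro integrable_mult_right gaussian_line_integral(1) c)
  show "(LINT x|lborel. exp (of_real pi * \<i> * \<tau> * (of_real x)\<^sup>2 - 2 * of_real pi * w * of_real x))
      = exp (\<i> * of_real pi * w\<^sup>2 / \<tau>) / csqrt (- \<i> * \<tau>)"
    unfolding eq using gaussian_line_integral(2)[OF c, of "w / c"] by (simp add: c_def)
qed

section \<open>Shifting the line of integration\<close>

lemma has_contour_integral_linepath_add:
  "(f has_contour_integral I) (linepath (a + c) (b + c)) \<longleftrightarrow>
   ((\<lambda>z. f (z + c)) has_contour_integral I) (linepath a b)"
  unfolding has_contour_integral_linepath by (simp add: linepath_def algebra_simps)

text \<open>Translating by \<open>\<i> * y\<close> moves the segment onto the real axis, where
  contour integrals are ordinary integrals over an interval.\<close>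

lemma contour_integral_horizontal:
  fixes f :: "complex \<Rightarrow> complex"
  assumes "continuous_on (closed_segment (Complex a y) (Complex b y)) f" "a < b"
  shows "contour_integral (linepath (Complex a y) (Complex b y)) f
    = integral {a..b} (\<lambda>x. f (of_real x + \<i> * of_real y))"
proof -
  have "f contour_integrable_on linepath (of_real a + \<i> * of_real y) (of_real b + \<i> * of_real y)"
    using contour_integrable_continuous_linepath[OF assms(1)] by (simp add: Complex_eq)
  then have "(f has_contour_integral contour_integral (linepath (Complex a y) (Complex b y)) f)
      (linepath (of_real a + \<i> * of_real y) (of_real b + \<i> * of_real y))"
    using has_contour_integral_integral by (fastforce simp: Complex_eq)
  from this[unfolded has_contour_integral_linepath_add]
  show ?thesis
    using assms(2) by (subst (asm) has_contour_integral_linepath_Reals_iff) (auto intro!: integral_unique[symmetric])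
qed

text \<open>The residue theorem on the rectangle with corners \<open>-R\<close> and \<open>R + \<i> Y\<close>; the decay hypothesis
  kills the vertical edges as \<open>R\<close> tends to infinity.\<close>
lemma horizontal_line_integral_shift:
  fixes F :: "complex \<Rightarrow> complex" and B :: "real \<Rightarrow> real"
  assumes Y: "Y > 0" and \<epsilon>: "\<epsilon> > 0" and pts: "finite pts" "pts \<subseteq> {z. 0 < Im z \<and> Im z < Y}"
    and hol: "F holomorphic_on {z. - \<epsilon> < Im z \<and> Im z < Y + \<epsilon>} - pts"
    and int0: "integrable lborel (\<lambda>x. F (of_real x))"
    and intY: "integrable lborel (\<lambda>x. F (of_real x + \<i> * of_real Y))"
    and decay: "\<And>z. \<bar>Re z\<bar> \<ge> L \<Longrightarrow> 0 \<le> Im z \<Longrightarrow> Im z \<le> Y \<Longrightarrow> norm (F z) \<le> B \<bar>Re z\<bar>"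
    and B: "(B \<longlongrightarrow> 0) at_top"
  shows "(LINT x|lborel. F (of_real x)) - (LINT x|lborel. F (of_real x + \<i> * of_real Y))
    = 2 * of_real pi * \<i> * (\<Sum>p\<in>pts. residue F p)"
proof -
  \<comment> \<open>An open neighbourhood of the closed strip, as the residue theorem requires; its
    convexity makes winding numbers vanish outside it.\<close>
  define S where "S = {z. - \<epsilon> < Im z \<and> Im z < Y + \<epsilon>}"
  have S_eq: "S = {z. Im z > - \<epsilon>} \<inter> {z. Im z < Y + \<epsilon>}" by (auto simp: S_def)
  have S: "open S" "convex S"
    unfolding S_eq by (intro open_Int open_halfspace_Im_gt open_halfspace_Im_lt
        convex_Int convex_halfspace_Im_gt convex_halfspace_Im_lt)+
  \<comment> \<open>For \<open>R > M\<close> every exceptional point lies strictly inside the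
    rectangle and has winding number 1.\<close>
  obtain M where M: "\<And>p. p \<in> pts \<Longrightarrow> \<bar>Re p\<bar> \<le> M"
    using finite_imp_bounded[OF finite_imageI[OF pts(1), of Re]] by (auto simp: bounded_real)
  have main: "integral {-R..R} (\<lambda>x. F (of_real x)) - integral {-R..R} (\<lambda>x. F (of_real x + \<i> * of_real Y))
      + (contour_integral (linepath (Complex R 0) (Complex R Y)) F
         - contour_integral (linepath (Complex (-R) 0) (Complex (-R) Y)) F)
      = 2 * of_real pi * \<i> * (\<Sum>p\<in>pts. residue F p)"
    and V: "norm (contour_integral (linepath (Complex R 0) (Complex R Y)) F
         - contour_integral (linepath (Complex (-R) 0) (Complex (-R) Y)) F) \<le> 2 * (B R * Y)"
    if R: "R > 0" "R > M" "R \<ge> L" for R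
  proof -
    define a b c d where "a = Complex (-R) 0" and "b = Complex R 0" and "c = Complex R Y" and "d = Complex (-R) Y"
    have rect: "rectpath a c = linepath a b +++ linepath b c +++ linepath c d +++ linepath d a"
      by (simp add: rectpath_def Let_def a_def b_def c_def d_def)
    have ac: "Re a < Re c" "Im a < Im c" using R Y by (auto simp: a_def c_def)
    have box: "p \<in> box a c" if "p \<in> pts" for p
      using M[OF that] pts(2) that R by (auto simp: in_box_complex_iff a_def c_def)
    have img: "path_image (rectpath a c) \<subseteq> S - pts"
    proof -
      have "path_image (rectpath a c) \<subseteq> cbox a c"
        using ac by (intro path_image_rectpath_subset_cbox) auto
      moreover have "cbox a c \<subseteq> S"
        using \<epsilon> Y by (auto simp: in_cbox_complex_iff S_def a_def c_def)
      moreover have "path_image (rectpath a c) \<inter> box a c = {}"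
        using ac by (intro path_image_rectpath_inter_box) auto
      ultimately show ?thesis using box by blast
    qed
    have segs: "closed_segment a b \<subseteq> S - pts" "closed_segment b c \<subseteq> S - pts"
      "closed_segment c d \<subseteq> S - pts" "closed_segment d a \<subseteq> S - pts"
      using img unfolding rect by (auto simp: path_image_join)
    have cont: "continuous_on (S - pts) F"
      using hol unfolding S_def[symmetric] by (rule holomorphic_on_imp_continuous_on)
    have ci: "F contour_integrable_on linepath p q" if "closed_segment p q \<subseteq> S - pts" for p q
      using continuous_on_subset[OF cont that] by (rule contour_integrable_continuous_linepath)
    have "contour_integral (rectpath a c) F
        = complex_of_real (2 * pi) * \<i> * (\<Sum>p\<in>pts. winding_number (rectpath a c) p * residue F p)"
    proof (rule Residue_theorem[of S])
      show "\<forall>z. z \<notin> S \<longrightarrow> winding_number (rectpath a c) z = 0"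
        using img S(2) by (intro allI impI winding_number_zero_outside[of _ S]) auto
    qed (use S pts(1) hol img in \<open>auto simp: S_def convex_connected\<close>)
    also have "(\<Sum>p\<in>pts. winding_number (rectpath a c) p * residue F p) = (\<Sum>p\<in>pts. residue F p)"
      by (intro sum.cong refl) (simp add: winding_number_rectpath box)
    finally have "contour_integral (linepath a b) F + contour_integral (linepath b c) F
        + contour_integral (linepath c d) F + contour_integral (linepath d a) F
        = 2 * of_real pi * \<i> * (\<Sum>p\<in>pts. residue F p)"
      unfolding rect using segs by (simp add: ci add.assoc)
    moreover have "contour_integral (linepath c d) F = - contour_integral (linepath d c) F"
      "contour_integral (linepath d a) F = - contour_integral (linepath a d) F"
      using contour_integral_reversepath[of "linepath c d" F] contour_integral_reversepath[of "linepath d a" F]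
      by simp_all
    moreover have "contour_integral (linepath a b) F = integral {-R..R} (\<lambda>x. F (of_real x))"
      using contour_integral_horizontal[of "-R" 0 R F] R continuous_on_subset[OF cont segs(1)]
      by (simp add: a_def b_def)
    moreover have "contour_integral (linepath d c) F = integral {-R..R} (\<lambda>x. F (of_real x + \<i> * of_real Y))"
      using contour_integral_horizontal[of "-R" Y R F] R continuous_on_subset[OF cont segs(3)]
      by (simp add: c_def d_def closed_segment_commute)
    ultimately show "integral {-R..R} (\<lambda>x. F (of_real x)) - integral {-R..R} (\<lambda>x. F (of_real x + \<i> * of_real Y))
      + (contour_integral (linepath (Complex R 0) (Complex R Y)) F
         - contour_integral (linepath (Complex (-R) 0) (Complex (-R) Y)) F)
      = 2 * of_real pi * \<i> * (\<Sum>p\<in>pts. residue F p)"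
      by (simp add: a_def b_def c_def d_def algebra_simps)
    have "norm (contour_integral (linepath (Complex x 0) (Complex x Y)) F) \<le> B R * Y"
      if x: "\<bar>x\<bar> = R" and seg: "closed_segment (Complex x 0) (Complex x Y) \<subseteq> S - pts" for x
    proof -
      \<comment> \<open>The decay bound at one point of the edge shows \<open>B R \<ge> 0\<close>,
        which the length estimate needs.\<close>
      have "norm (F (Complex x 0)) \<le> B R" using decay[of "Complex x 0"] R Y x by simp
      then have "B R \<ge> 0" using norm_ge_zero order_trans by blast
      have "norm (contour_integral (linepath (Complex x 0) (Complex x Y)) F)
          \<le> B R * norm (Complex x Y - Complex x 0)"
      proof (rule contour_integral_bound_linepath)
        fix z assume "z \<in> closed_segment (Complex x 0) (Complex x Y)"
        then have "Re z = x" "Im z \<in> {0..Y}"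
          using Y by (auto simp: closed_segment_same_Re closed_segment_eq_real_ivl)
        then show "norm (F z) \<le> B R" using decay[of z] x R by simp
      qed (use ci[OF seg] \<open>B R \<ge> 0\<close> in auto)
      also have "norm (Complex x Y - Complex x 0) = Y" using Y by (simp add: cmod_def)
      finally show ?thesis .
    qed
    from this[of R] this[of "-R"] segs(2,4) R
    have "norm (contour_integral (linepath (Complex R 0) (Complex R Y)) F) \<le> B R * Y"
      "norm (contour_integral (linepath (Complex (-R) 0) (Complex (-R) Y)) F) \<le> B R * Y"
      by (auto simp: a_def b_def c_def d_def closed_segment_commute)
    then show "norm (contour_integral (linepath (Complex R 0) (Complex R Y)) F
         - contour_integral (linepath (Complex (-R) 0) (Complex (-R) Y)) F) \<le> 2 * (B R * Y)"
      using norm_triangle_ineq4[of "contour_integral (linepath (Complex R 0) (Complex R Y)) F"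
          "contour_integral (linepath (Complex (-R) 0) (Complex (-R) Y)) F"] by linarith
  qed
  define E where "E = (\<lambda>R. contour_integral (linepath (Complex R 0) (Complex R Y)) F
         - contour_integral (linepath (Complex (-R) 0) (Complex (-R) Y)) F)"
  have ev: "\<forall>\<^sub>F R in at_top. R > 0 \<and> R > M \<and> R \<ge> L"
    by (intro eventually_conj eventually_gt_at_top eventually_ge_at_top)
  have "(E \<longlongrightarrow> 0) at_top"
  proof (rule Lim_null_comparison)
    show "\<forall>\<^sub>F R in at_top. norm (E R) \<le> 2 * (B R * Y)"
      using ev by eventually_elim (auto simp: E_def intro!: V)
    show "((\<lambda>R. 2 * (B R * Y)) \<longlongrightarrow> 0) at_top"
      using tendsto_mult[OF tendsto_const[of 2] tendsto_mult[OF B tendsto_const[of Y]]] by simp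
  qed
  then have lim1: "((\<lambda>R. integral {-R..R} (\<lambda>x. F (of_real x)) - integral {-R..R} (\<lambda>x. F (of_real x + \<i> * of_real Y)) + E R)
      \<longlongrightarrow> (LINT x|lborel. F (of_real x)) - (LINT x|lborel. F (of_real x + \<i> * of_real Y)) + 0) at_top"
    by (intro tendsto_add tendsto_diff tendsto_integral_symmetric_interval int0 intY)
  have lim2: "((\<lambda>R. integral {-R..R} (\<lambda>x. F (of_real x)) - integral {-R..R} (\<lambda>x. F (of_real x + \<i> * of_real Y)) + E R)
      \<longlongrightarrow> 2 * of_real pi * \<i> * (\<Sum>p\<in>pts. residue F p)) at_top"
    by (rule tendsto_eventually) (use ev in \<open>eventually_elim, auto simp: E_def intro!: main\<close>)
  from tendsto_unique[OF trivial_limit_at_top_linorder lim1 lim2] show ?thesis by simp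
qed

section \<open>Dirichlet characters and Gauss sums\<close>

lemma periodic_int_mod:
  fixes f :: "int \<Rightarrow> 'a"
  assumes "\<And>n. f (n + int N) = f n"
  shows "f (n mod int N) = f n"
proof -
  have plus: "f (n + int m * int N) = f n" for n m
  proof (induction m)
    case (Suc m)
    then show ?case using assms[of "n + int m * int N"] by (simp add: algebra_simps)
  qed simp
  show ?thesis
  proof (cases "n div int N \<ge> 0")
    case True
    then show ?thesis using plus[of "n mod int N" "nat (n div int N)"] by simp
  next
    case False
    then show ?thesis using plus[of n "nat (- (n div int N))"] by (simp add: minus_div_mult_eq_mod)
  qed
qed

lemma periodic_int_cong:
  fixes f :: "int \<Rightarrow> 'a"
  assumes "\<And>n. f (n + int N) = f n" "[m = n] (mod int N)"
  shows "f m = f n"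
  using periodic_int_mod[of f N m] periodic_int_mod[of f N n] assms by (simp add: cong_def)

text \<open>Multiplication by a unit permutes the residues modulo \<open>N\<close>. All character
  sum identities below rest on this substitution.\<close>

lemma sum_periodic_mult_coprime:
  fixes f :: "int \<Rightarrow> 'a::comm_monoid_add"
  assumes f: "\<And>n. f (n + int N) = f n" and "N > 0" and a: "coprime a (int N)"
  shows "(\<Sum>n\<in>{0..<int N}. f (a * n)) = (\<Sum>n\<in>{0..<int N}. f n)"
proof -
  have inj: "inj_on (\<lambda>n. a * n mod int N) {0..<int N}"
  proof (rule inj_onI)
    fix m n assume "m \<in> {0..<int N}" "n \<in> {0..<int N}" "a * m mod int N = a * n mod int N"
    then have "[m = n] (mod int N)"
      using a by (simp add: cong_def[symmetric] cong_mult_lcancel)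
    then show "m = n" using \<open>m \<in> _\<close> \<open>n \<in> _\<close> by (simp add: cong_def)
  qed
  moreover have "(\<lambda>n. a * n mod int N) ` {0..<int N} \<subseteq> {0..<int N}" using \<open>N > 0\<close> by auto
  ultimately have img: "(\<lambda>n. a * n mod int N) ` {0..<int N} = {0..<int N}"
    by (intro endo_inj_surj) auto
  have "(\<Sum>n\<in>{0..<int N}. f n) = (\<Sum>n\<in>{0..<int N}. f (a * n mod int N))"
    using sum.reindex[OF inj, of f] by (simp add: img)
  also have "\<dots> = (\<Sum>n\<in>{0..<int N}. f (a * n))"
    by (simp add: periodic_int_mod[of f N, OF f])
  finally show ?thesis ..
qed

lemma dirichlet_characterD:
  assumes "dirichlet_character N chi"
  shows "chi 1 = 1" "chi (n + int N) = chi n" "chi (m * n) = chi m * chi n"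
    "chi n = 0 \<longleftrightarrow> gcd n (int N) > 1"
  using assms unfolding dirichlet_character_def by blast+

lemma dirichlet_character_eq_0_iff:
  assumes "dirichlet_character N chi" "N > 0"
  shows "chi n = 0 \<longleftrightarrow> \<not> coprime n (int N)"
proof -
  have "gcd n (int N) \<ge> 1"
    using assms(2) by (metis gcd_ge_0_int gcd_eq_0_iff int_one_le_iff_zero_less less_le of_nat_eq_0_iff neq0_conv)
  then show ?thesis
    using dirichlet_characterD(4)[OF assms(1), of n] by (auto simp: coprime_iff_gcd_eq_1)
qed

lemma dirichlet_character_power:
  assumes "dirichlet_character N chi"
  shows "chi (n ^ k) = chi n ^ k"
  by (induction k) (simp_all add: dirichlet_characterD[OF assms])

text \<open>The term \<open>n = 0\<close> may be added because \<open>gcd 0 N = N > 1\<close> forces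
  \<open>chi 0 = 0\<close>. A complete residue system is what substitutions need.\<close>

lemma dirichlet_character_sum_residues:
  fixes f :: "int \<Rightarrow> complex"
  assumes "dirichlet_character N chi" "N \<ge> 2"
  shows "(\<Sum>n=1..N-1. chi (int n) * f (int n)) = (\<Sum>n\<in>{0..<int N}. chi n * f n)"
proof -
  have "chi 0 = 0" using assms by (simp add: dirichlet_characterD(4)[OF assms(1)])
  have "(\<Sum>n\<in>{0..<int N}. chi n * f n) = (\<Sum>n\<in>int ` {0..<N}. chi n * f n)"
    by (simp add: image_int_atLeastLessThan)
  also have "\<dots> = (\<Sum>n\<in>{0..<N}. chi (int n) * f (int n))"
    by (subst sum.reindex) auto
  also have "\<dots> = (\<Sum>n=1..N-1. chi (int n) * f (int n))"
    using assms(2) \<open>chi 0 = 0\<close> by (intro sum.mono_neutral_right) (auto simp: not_le)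
  finally show ?thesis ..
qed

text \<open>Substituting \<open>a * n\<close> for a unit \<open>a\<close> with
  \<open>chi a \<noteq> 1\<close> multiplies the sum by \<open>chi a\<close> without changing
  it.\<close>

lemma nonprincipal_character_sum_eq_0:
  assumes chi: "dirichlet_character N chi" and "N \<ge> 2" and "\<not> principal_character N chi"
  shows "(\<Sum>n=1..N-1. chi (int n)) = 0"
proof -
  obtain a where a: "coprime a (int N)" "chi a \<noteq> 1"
    using assms(3) by (auto simp: principal_character_def coprime_iff_gcd_eq_1)
  define T where "T = (\<Sum>n\<in>{0..<int N}. chi n)"
  have "T = (\<Sum>n\<in>{0..<int N}. chi (a * n))"
    unfolding T_def using \<open>N \<ge> 2\<close> a
    by (intro sum_periodic_mult_coprime[symmetric] dirichlet_characterD[OF chi]) auto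
  also have "\<dots> = chi a * T"
    by (simp add: T_def dirichlet_characterD(3)[OF chi] sum_distrib_left)
  finally have "T = 0" using a by auto
  then show ?thesis
    using dirichlet_character_sum_residues[OF chi \<open>N \<ge> 2\<close>, of "\<lambda>_. 1"] by (simp add: T_def)
qed

text \<open>By Euler's theorem \<open>chi k\<close> is a root of unity, so its conjugate is its
  inverse.\<close>

lemma dirichlet_character_mult_cnj:
  assumes chi: "dirichlet_character N chi" and "N \<ge> 2" and "coprime k N"
  shows "cnj (chi (int k)) * chi (int k) = 1"
proof -
  have "[int (k ^ totient N) = int 1] (mod int N)"
    unfolding cong_int_iff using assms(3) by (rule euler_theorem)
  then have "chi (int k ^ totient N) = chi 1"
    using periodic_int_cong[of chi N, OF dirichlet_characterD(2)[OF chi]] by fastforce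
  then have "chi (int k) ^ totient N = 1"
    by (simp add: dirichlet_character_power[OF chi] dirichlet_characterD(1)[OF chi])
  moreover have "totient N > 0" using \<open>N \<ge> 2\<close> by simp
  ultimately have "norm (chi (int k)) = 1"
    using norm_power[of "chi (int k)" "totient N"] power_eq_imp_eq_base[of "norm (chi (int k))" "totient N" 1]
    by simp
  then show ?thesis
    by (metis complex_norm_square mult.commute of_real_1 one_power2)
qed

section \<open>Descent of a character to a divisor of its modulus\<close>

text \<open>For \<open>d\<close> dividing \<open>N\<close> this says that units modulo
  \<open>d\<close> lift to units modulo \<open>N\<close>.\<close>

lemma exists_coprime_lift:
  fixes n d N :: int
  assumes "coprime n d" "N \<noteq> 0"
  obtains q where "coprime (n + d * q) N"
proof -
  \<comment> \<open>A prime divisor of \<open>N\<close> that divides \<open>n\<close> divides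
    neither \<open>d\<close> nor \<open>q\<close>; one that does not divide \<open>n\<close> divides
    \<open>q\<close>. In both cases it divides exactly one of \<open>n\<close> and
    \<open>d * q\<close>, hence not their sum.\<close>
  define q where "q = \<Prod>{p. prime p \<and> p dvd N \<and> \<not> p dvd n}"
  have fin: "finite {p. prime p \<and> p dvd N \<and> \<not> p dvd n}"
    by (rule finite_subset[of _ "{p. prime p \<and> p dvd N}"]) (use assms(2) finite_prime_divisors in auto)
  have "\<not> p dvd n + d * q" if p: "prime p" "p dvd N" for p
  proof (cases "p dvd n")
    case True
    then have "\<not> p dvd d" using assms(1) p(1) by (meson coprime_common_divisor not_prime_unit)
    moreover have "\<not> p dvd q"
    proof
      assume "p dvd q"
      then obtain r where "prime r" "\<not> r dvd n" "p dvd r"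
        using prime_dvd_prod_iff[OF fin p(1), of "\<lambda>x. x"] by (auto simp: q_def)
      then show False using True p(1) primes_dvd_imp_eq by blast
    qed
    ultimately show ?thesis using True p(1) by (simp add: dvd_add_right_iff prime_dvd_mult_iff)
  next
    case False
    then have "p dvd q" unfolding q_def using p by (intro dvd_prodI fin[THEN dvd_prodI, of p "\<lambda>x. x", simplified]) auto
    then show ?thesis using False by (simp add: dvd_add_left_iff)
  qed
  moreover have "coprime x N" if np: "\<And>p. prime p \<Longrightarrow> p dvd N \<Longrightarrow> \<not> p dvd x" for x
  proof (rule coprimeI)
    fix c assume c: "c dvd x" "c dvd N"
    then have "c \<noteq> 0" using assms(2) by auto
    show "is_unit c"
    proof (rule ccontr)
      assume "\<not> is_unit c"
      with \<open>c \<noteq> 0\<close> obtain p where "prime p" "p dvd c" by (rule prime_divisorE)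
      with c np show False by (meson dvd_trans)
    qed
  qed
  ultimately have "coprime (n + d * q) N" by blast
  with that show ?thesis .
qed

text \<open>Criterion for imprimitivity: the value at \<open>n\<close> of the inducing character is read off any
  lift of \<open>n\<close> to a unit modulo \<open>N\<close>.\<close>
lemma induced_by_divisorI:
  assumes chi: "dirichlet_character N chi" and "N > 0" and "d dvd N"
    and triv: "\<And>c. coprime c (int N) \<Longrightarrow> [c = 1] (mod int d) \<Longrightarrow> chi c = 1"
  obtains psi where "induced_by N chi d psi"
proof -
  have "d > 0" using assms(2,3) by (auto intro: Nat.gr0I)
  \<comment> \<open>An arbitrary choice; \<open>chi_eq\<close> below shows that the value of
    \<open>chi\<close> does not depend on it.\<close>
  define lift where "lift n = (SOME m. coprime m (int N) \<and> [m = n] (mod int d))" for n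
  define psi where "psi n = (if coprime n (int d) then chi (lift n) else 0)" for n
  have lift: "coprime (lift n) (int N)" "[lift n = n] (mod int d)" if n: "coprime n (int d)" for n
  proof -
    obtain q where "coprime (n + int d * q) (int N)"
      using exists_coprime_lift[OF n, of "int N"] \<open>N > 0\<close> by auto
    then have "\<exists>m. coprime m (int N) \<and> [m = n] (mod int d)"
      by (intro exI[of _ "n + int d * q"]) (simp add: cong_def)
    from someI_ex[OF this] show "coprime (lift n) (int N)" "[lift n = n] (mod int d)"
      by (simp_all add: lift_def)
  qed
  have cop: "coprime m (int d)" if "coprime m (int N)" for m
    using that \<open>d dvd N\<close> by (meson coprime_divisors dvd_refl int_dvd_int_iff)
  \<comment> \<open>With \<open>n'\<close> an inverse of \<open>n\<close> modulo \<open>N\<close>,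
    the unit \<open>m * n'\<close> is congruent to 1 modulo \<open>d\<close>, so \<open>triv\<close>
    gives \<open>chi (m * n') = 1 = chi (n * n')\<close>.\<close>
  have chi_eq: "chi m = chi n"
    if m: "coprime m (int N)" and n: "coprime n (int N)" and mn: "[m = n] (mod int d)" for m n
  proof -
    obtain n' where n': "[n * n' = 1] (mod int N)" using cong_solve_coprime_int[OF n] by blast
    then have "coprime n' (int N)"
      by (metis coprime_iff_invertible_int mult.commute)
    have "[m * n' = n * n'] (mod int d)" using mn by (rule cong_scalar_right)
    moreover have "[n * n' = 1] (mod int d)"
      using n' \<open>d dvd N\<close> cong_dvd_modulus by (metis int_dvd_int_iff)
    ultimately have "chi (m * n') = 1"
      using m \<open>coprime n' (int N)\<close> by (intro triv) (auto intro: cong_trans)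
    moreover have "chi (n * n') = 1"
      using periodic_int_cong[of chi N, OF dirichlet_characterD(2)[OF chi] n']
      by (simp add: dirichlet_characterD(1)[OF chi])
    ultimately have "chi m * chi n' = chi n * chi n'" "chi n' \<noteq> 0"
      by (auto simp: dirichlet_characterD(3)[OF chi])
    then show ?thesis by simp
  qed
  have psi_eq: "psi n = chi m" if "coprime n (int d)" "coprime m (int N)" "[m = n] (mod int d)" for m n
    using that lift[OF that(1)] by (auto simp: psi_def intro!: chi_eq intro: cong_trans cong_sym)
  have "dirichlet_character d psi"
    unfolding dirichlet_character_def
  proof (intro conjI allI)
    show "psi 1 = 1" using psi_eq[of 1 1] by (simp add: dirichlet_characterD(1)[OF chi])
    fix n m :: int
    show "psi (n + int d) = psi n"
    proof (cases "coprime n (int d)")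
      case True
      have "[n = n + int d] (mod int d)" by (simp add: cong_def)
      moreover have "coprime (n + int d) (int d)" using True by (simp add: coprime_iff_gcd_eq_1)
      ultimately show ?thesis
        using lift[OF True] by (metis True cong_trans psi_eq)
    qed (simp add: psi_def coprime_iff_gcd_eq_1)
    show "psi (m * n) = psi m * psi n"
    proof (cases "coprime m (int d) \<and> coprime n (int d)")
      case True
      then have "psi (m * n) = chi (lift m * lift n)"
        by (intro psi_eq) (auto intro!: cong_mult lift)
      then show ?thesis using True by (simp add: psi_def dirichlet_characterD(3)[OF chi])
    qed (auto simp: psi_def)
    show "psi n = 0 \<longleftrightarrow> gcd n (int d) > 1"
    proof (cases "coprime n (int d)")
      case True
      then show ?thesis
        using lift(1)[OF True] dirichlet_character_eq_0_iff[OF chi \<open>N > 0\<close>] by (simp add: psi_def)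
    next
      case False
      have "gcd n (int d) \<ge> 1"
        using \<open>d > 0\<close> by (metis gcd_ge_0_int gcd_eq_0_iff int_one_le_iff_zero_less less_le of_nat_eq_0_iff neq0_conv)
      then show ?thesis using False by (auto simp: psi_def coprime_iff_gcd_eq_1)
    qed
  qed
  moreover have "chi n = psi n" if "gcd n (int N) = 1" for n
    using that cop psi_eq[of n n] by (simp add: coprime_iff_gcd_eq_1)
  ultimately show ?thesis using that \<open>d dvd N\<close> by (auto simp: induced_by_def)
qed

section \<open>Twisted Gauss sums\<close>

text \<open>For \<open>k\<close> coprime to \<open>N\<close> this is the substitution by
  \<open>k\<close>. Otherwise the right side is 0, and primitivity is what forces the left side to
  vanish as well.\<close>

lemma primitive_character_twisted_gauss_sum:
  assumes prim: "primitive_character N chi" and "N \<ge> 2"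
  shows "(\<Sum>n=1..N-1. chi (int n) * exp (2 * of_real pi * \<i> * of_nat k * of_nat n / of_nat N))
    = cnj (chi (int k)) * gauss_sum N chi"
proof -
  have chi: "dirichlet_character N chi" using prim by (simp add: primitive_character_def)
  note chiD = dirichlet_characterD[OF chi]
  define e where "e m = exp (2 * of_real pi * \<i> * of_int m / of_nat N)" for m :: int
  have e: "e (m + int N) = e m" for m
  proof -
    have "2 * of_real pi * \<i> * of_int (m + int N) / of_nat N
      = 2 * of_real pi * \<i> * of_int m / of_nat N + 2 * of_real pi * \<i>"
      using \<open>N \<ge> 2\<close> by (simp add: field_simps)
    then show ?thesis unfolding e_def by (simp add: exp_add)
  qed
  define S where "S k = (\<Sum>n\<in>{0..<int N}. chi n * e (k * n))" for k
  have e_cong: "e m = e n" if "[m = n] (mod int N)" for m n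
    using periodic_int_cong[of e N, OF e that] .
  have chi_cong: "chi m = chi n" if "[m = n] (mod int N)" for m n
    using periodic_int_cong[of chi N, OF chiD(2) that] .
  \<comment> \<open>Substitution of \<open>c * n\<close> for \<open>n\<close>. With
    \<open>k = 1\<close> it evaluates the sum at units; with \<open>k * c\<close> congruent to
    \<open>k\<close> it yields \<open>chi c = 1\<close> whenever
    \<open>S k \<noteq> 0\<close>.\<close>
  have chi_S: "chi c * S (k * c) = S k" if c: "coprime c (int N)" for c k
  proof -
    have "S k = (\<Sum>n\<in>{0..<int N}. chi (c * n) * e (k * (c * n)))"
      unfolding S_def
    proof (rule sum_periodic_mult_coprime[symmetric])
      show "chi (n + int N) * e (k * (n + int N)) = chi n * e (k * n)" for n
        using e_cong[of "k * (n + int N)" "k * n"] by (simp add: chiD(2) cong_def distrib_left)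
    qed (use c \<open>N \<ge> 2\<close> in auto)
    also have "\<dots> = chi c * S (k * c)"
      by (simp add: S_def sum_distrib_left chiD(3) mult_ac)
    finally show ?thesis ..
  qed
  have S_cong: "S k = S l" if "[k = l] (mod int N)" for k l
    unfolding S_def by (intro sum.cong refl arg_cong2[of _ _ _ _ "(*)"] e_cong cong_scalar_right that)
  have S_sum: "S (int k) = (\<Sum>n=1..N-1. chi (int n) * exp (2 * of_real pi * \<i> * of_nat k * of_nat n / of_nat N))" for k
    using dirichlet_character_sum_residues[OF chi \<open>N \<ge> 2\<close>, of "\<lambda>n. e (int k * n)"]
    by (simp add: S_def e_def mult_ac)
  have gauss: "gauss_sum N chi = S 1"
    using S_sum[of 1] by (simp add: gauss_sum_def)
  show ?thesis
  proof (cases "coprime k N")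
    case True
    then have "chi (int k) * S (int k) = S 1" using chi_S[of "int k" 1] by simp
    then have "cnj (chi (int k)) * chi (int k) * S (int k) = cnj (chi (int k)) * S 1" by (simp add: mult.assoc)
    then show ?thesis
      using dirichlet_character_mult_cnj[OF chi \<open>N \<ge> 2\<close> True] by (simp add: gauss S_sum)
  next
    case False
    have "S (int k) = 0"
    proof (rule ccontr)
      assume nz: "S (int k) \<noteq> 0"
      define g where "g = gcd k N"
      \<comment> \<open>\<open>k * d\<close> is a multiple of \<open>N\<close>, so \<open>c\<close>
        congruent to 1 modulo \<open>d\<close> implies \<open>k * c\<close> congruent to
        \<open>k\<close> modulo \<open>N\<close>.\<close>
      define d where "d = N div g"
      have N_eq: "N = d * g" by (simp add: d_def g_def)
      have "g > 1" using False \<open>N \<ge> 2\<close> by (metis g_def coprime_iff_gcd_eq_1 gcd_eq_0_iff less_one linorder_neqE_nat not_numeral_le_zero)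
      have "d \<noteq> N" using N_eq \<open>g > 1\<close> \<open>N \<ge> 2\<close> by (cases "d = 0") auto
      obtain k' where k': "k = g * k'" unfolding g_def by (metis dvdE gcd_dvd1)
      have "chi c = 1" if c: "coprime c (int N)" "[c = 1] (mod int d)" for c
      proof -
        obtain t where "c = 1 + int d * t" using c(2) by (metis cong_iff_lin cong_sym)
        then have "int k * c = int k + int N * (int k' * t)"
          by (simp add: k' N_eq algebra_simps)
        then have "[int k * c = int k] (mod int N)" by (simp add: cong_def)
        from S_cong[OF this] chi_S[OF c(1), of "int k"] nz show ?thesis by simp
      qed
      then obtain psi where "induced_by N chi d psi"
        using induced_by_divisorI[OF chi, of d] \<open>N \<ge> 2\<close> N_eq by (metis dvd_triv_left not_numeral_le_zero gr0I)
      with prim \<open>d \<noteq> N\<close> show False by (auto simp: primitive_character_def)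
    qed
    moreover have "chi (int k) = 0"
      using False dirichlet_character_eq_0_iff[OF chi] \<open>N \<ge> 2\<close> by simp
    ultimately show ?thesis by (simp add: S_sum)
  qed
qed

section \<open>The function \<open>\<Phi>\<close>\<close>

definition Phi_num :: "nat \<Rightarrow> (int \<Rightarrow> complex) \<Rightarrow> complex \<Rightarrow> complex" where
  "Phi_num N chi x = (\<Sum>n=1..N-1. chi (int n) * exp (2 * of_real pi * of_nat n * x / of_real (sqrt (real N))))"

text \<open>This is \<open>1 - t ^ N\<close> at \<open>t = exp (2 * pi * x / sqrt N)\<close>, since
  \<open>N / sqrt N = sqrt N\<close>.\<close>

definition Phi_den :: "nat \<Rightarrow> complex \<Rightarrow> complex" where
  "Phi_den N x = 1 - exp (2 * of_real pi * of_real (sqrt (real N)) * x)"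

lemma of_real_sqrt_mult_self: "complex_of_real (sqrt (real N)) * complex_of_real (sqrt (real N)) = of_nat N"
  by (simp flip: of_real_mult)

lemma Phi_N_eq_remove_sings:
  assumes "N > 0"
  shows "Phi_N N chi = remove_sings (\<lambda>x. Phi_num N chi x / Phi_den N x)"
proof -
  have pow: "exp (2 * of_real pi * x / of_real (sqrt (real N))) ^ n
      = exp (2 * of_real pi * of_nat n * x / of_real (sqrt (real N)))" for n and x :: complex
    by (simp flip: exp_of_nat_mult add: mult_ac)
  have "(of_nat N :: complex) / of_real (sqrt (real N)) = of_real (sqrt (real N))"
    using assms of_real_sqrt_mult_self[of N] by (simp add: divide_eq_eq)
  then have N: "2 * of_real pi * of_nat N * x / of_real (sqrt (real N)) = 2 * of_real pi * of_real (sqrt (real N)) * x"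
    for x :: complex
    by (metis (no_types, opaque_lifting) mult.assoc mult.commute times_divide_eq_right)
  show ?thesis
    unfolding Phi_N_def phi_N_def pow Phi_num_def Phi_den_def N ..
qed

lemma Phi_num_holomorphic: "Phi_num N chi holomorphic_on A"
  unfolding Phi_num_def by (cases "N = 0") (auto intro!: holomorphic_intros)

lemma Phi_den_holomorphic: "Phi_den N holomorphic_on A"
  unfolding Phi_den_def by (intro holomorphic_intros)

lemma Phi_num_analytic: "Phi_num N chi analytic_on A"
  using Phi_num_holomorphic[of N chi UNIV] by (metis analytic_on_open analytic_on_subset open_UNIV top_greatest)

lemma Phi_den_analytic: "Phi_den N analytic_on A"
  using Phi_den_holomorphic[of N UNIV] by (metis analytic_on_open analytic_on_subset open_UNIV top_greatest)

lemma Phi_den_eq_0_iff: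
  assumes "N > 0"
  shows "Phi_den N x = 0 \<longleftrightarrow> (\<exists>k::int. x = \<i> * of_int k / of_real (sqrt (real N)))"
proof -
  have "Phi_den N x = 0 \<longleftrightarrow> Re x = 0 \<and> (\<exists>k::int. Im x * sqrt (real N) = of_int k)"
  proof -
    have "Phi_den N x = 0 \<longleftrightarrow> exp (2 * of_real pi * of_real (sqrt (real N)) * x) = 1"
      by (auto simp: Phi_den_def)
    also have "\<dots> \<longleftrightarrow> Re x = 0 \<and> (\<exists>k::int. 2 * pi * sqrt (real N) * Im x = of_int (2 * k) * pi)"
      unfolding exp_eq_1 using assms by simp
    also have "(\<lambda>k::int. 2 * pi * sqrt (real N) * Im x = of_int (2 * k) * pi) = (\<lambda>k. Im x * sqrt (real N) = of_int k)"
      by (auto simp: fun_eq_iff mult.commute)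
    finally show ?thesis .
  qed
  also have "\<dots> \<longleftrightarrow> (\<exists>k::int. x = \<i> * of_int k / of_real (sqrt (real N)))"
  proof -
    have "(Re x = 0 \<and> Im x * sqrt (real N) = of_int k) \<longleftrightarrow> x = \<i> * of_int k / of_real (sqrt (real N))" for k :: int
      using assms by (auto simp: complex_eq_iff field_simps)
    then show ?thesis by auto
  qed
  finally show ?thesis .
qed

lemma Phi_den_shift: "Phi_den N (x + \<i> * of_real (sqrt (real N))) = Phi_den N x"
proof -
  have "2 * of_real pi * of_real (sqrt (real N)) * (x + \<i> * of_real (sqrt (real N)))
      = 2 * of_real pi * of_real (sqrt (real N)) * x + 2 * of_real pi * \<i> * of_nat N"
    by (simp flip: of_real_sqrt_mult_self add: algebra_simps)
  moreover have "exp (2 * of_real pi * \<i> * of_nat N) = 1"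
    unfolding exp_eq_1 by (auto intro!: exI[of _ "int N"])
  ultimately show ?thesis by (simp add: Phi_den_def exp_add)
qed

lemma Phi_num_shift: "Phi_num N chi (x + \<i> * of_real (sqrt (real N))) = Phi_num N chi x"
proof (cases "N = 0")
  case False
  have "exp (2 * of_real pi * of_nat n * (x + \<i> * of_real (sqrt (real N))) / of_real (sqrt (real N)))
      = exp (2 * of_real pi * of_nat n * x / of_real (sqrt (real N)))" for n
  proof -
    have "2 * of_real pi * of_nat n * (x + \<i> * of_real (sqrt (real N))) / of_real (sqrt (real N))
        = 2 * of_real pi * of_nat n * x / of_real (sqrt (real N)) + 2 * of_real pi * \<i> * of_nat n"
      using False by (simp add: field_simps)
    moreover have "exp (2 * of_real pi * \<i> * of_nat n) = 1"
      unfolding exp_eq_1 by (auto intro!: exI[of _ "int n"])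
    ultimately show ?thesis by (simp add: exp_add)
  qed
  then show ?thesis by (simp add: Phi_num_def)
qed (simp add: Phi_num_def)

lemma Phi_N_shift:
  assumes "N > 0"
  shows "Phi_N N chi (x + \<i> * of_real (sqrt (real N))) = Phi_N N chi x"
proof -
  define q where "q = (\<lambda>x. Phi_num N chi x / Phi_den N x)"
  have q: "q (x + \<i> * of_real (sqrt (real N)) + w) = q (x + w)" for w
    using Phi_num_shift[of N chi "x + w"] Phi_den_shift[of N "x + w"] by (simp add: q_def add_ac)
  have "remove_sings q (x + \<i> * of_real (sqrt (real N))) = remove_sings q x"
    \<comment> \<open>Both values are expressed through translated quotients at 0, and these are the
      same function; the identity therefore also holds at singular points.\<close>
    by (subst (1 2) remove_sings_shift_0) (simp add: q)
  then show ?thesis using assms by (simp add: Phi_N_eq_remove_sings q_def)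
qed

lemma Phi_N_eq_quotient:
  assumes "N > 0" "Phi_den N x \<noteq> 0"
  shows "Phi_N N chi x = Phi_num N chi x / Phi_den N x"
  unfolding Phi_N_eq_remove_sings[OF assms(1)]
  by (intro remove_sings_at_analytic analytic_on_divide Phi_num_analytic Phi_den_analytic) (use assms in auto)

section \<open>Local behaviour at the zeros of the denominator\<close>

text \<open>The exponential equals 1 at every zero, so the derivative there is always
  \<open>- 2 * pi * sqrt N\<close>: all zeros are simple, with a common limit.\<close>

lemma tendsto_inverse_Phi_den:
  assumes "N > 0" "Phi_den N p = 0"
  shows "((\<lambda>w. (w - p) / Phi_den N w) \<longlongrightarrow> - 1 / (2 * of_real pi * of_real (sqrt (real N)))) (at p)"
proof -
  have e: "exp (2 * of_real pi * of_real (sqrt (real N)) * p) = 1" using assms(2) by (simp add: Phi_den_def)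
  have "(Phi_den N has_field_derivative
      - (exp (2 * of_real pi * of_real (sqrt (real N)) * p) * (2 * of_real pi * of_real (sqrt (real N))))) (at p)"
    unfolding Phi_den_def by (auto intro!: derivative_eq_intros)
  then have "((\<lambda>w. (Phi_den N w - Phi_den N p) / (w - p)) \<longlongrightarrow> - (2 * of_real pi * of_real (sqrt (real N)))) (at p)"
    unfolding has_field_derivative_iff e by simp
  from tendsto_inverse[OF this] show ?thesis
    using assms by (simp add: divide_simps)
qed

lemma Phi_quotient_isolated_singularity:
  assumes "N > 0"
  shows "isolated_singularity_at (\<lambda>x. Phi_num N chi x / Phi_den N x) p"
  by (intro isolated_singularity_at_divide isolated_singularity_at_analytic not_essential_analytic
      Phi_num_analytic Phi_den_analytic)

text \<open>A simple zero of the denominator is cancelled by any zero of the numerator, so the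
  quotient has a finite limit, which \<open>remove_sings\<close> takes as its value.\<close>

lemma Phi_N_analytic_at:
  assumes "N > 0" and "Phi_den N p = 0 \<Longrightarrow> Phi_num N chi p = 0"
  shows "Phi_N N chi analytic_on {p}"
proof (cases "Phi_den N p = 0")
  case False
  then show ?thesis unfolding Phi_N_eq_remove_sings[OF assms(1)]
    by (intro remove_sings_analytic_on analytic_on_divide Phi_num_analytic Phi_den_analytic) auto
next
  case True
  have "(Phi_num N chi has_field_derivative deriv (Phi_num N chi) p) (at p)"
    using Phi_num_holomorphic[of N chi UNIV] by (intro holomorphic_derivI) auto
  then have "((\<lambda>w. Phi_num N chi w / (w - p)) \<longlongrightarrow> deriv (Phi_num N chi) p) (at p)"
    using assms(2)[OF True] by (simp add: has_field_derivative_iff)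
  from tendsto_mult[OF this tendsto_inverse_Phi_den[OF assms(1) True]]
  have lim: "((\<lambda>w. Phi_num N chi w / (w - p) * ((w - p) / Phi_den N w)) \<longlongrightarrow>
      deriv (Phi_num N chi) p * (- 1 / (2 * of_real pi * of_real (sqrt (real N))))) (at p)" .
  have "((\<lambda>w. Phi_num N chi w / Phi_den N w) \<longlongrightarrow>
      deriv (Phi_num N chi) p * (- 1 / (2 * of_real pi * of_real (sqrt (real N))))) (at p)"
    by (rule Lim_transform_eventually[OF lim]) (auto simp: eventually_at intro!: exI[of _ 1])
  then show ?thesis unfolding Phi_N_eq_remove_sings[OF assms(1)]
    by (intro remove_sings_analytic_at Phi_quotient_isolated_singularity assms(1))
qed

text \<open>The pole is at most simple, so the residue is the limit of \<open>(w - p)\<close> times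
  the function. The entire factor \<open>E\<close> will be the Gaussian exponential.\<close>

lemma residue_Phi_N_times:
  assumes "N > 0" "Phi_den N p = 0" "E holomorphic_on UNIV" "open S" "p \<in> S"
    and hol: "Phi_N N chi holomorphic_on S - {p}"
  shows "residue (\<lambda>x. Phi_N N chi x * E x) p = - (Phi_num N chi p * E p) / (2 * of_real pi * of_real (sqrt (real N)))"
proof (rule residue_simple'[OF \<open>open S\<close> \<open>p \<in> S\<close>])
  show "(\<lambda>x. Phi_N N chi x * E x) holomorphic_on S - {p}"
    using assms(3) by (intro holomorphic_on_mult hol) (auto intro: holomorphic_on_subset)
  have "isCont (Phi_num N chi) p" "isCont E p"
    using Phi_num_holomorphic[of N chi UNIV] assms(3)
    by (auto dest!: holomorphic_on_imp_continuous_on simp: continuous_on_eq_continuous_at)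
  then have lim: "((\<lambda>w. Phi_num N chi w * E w * ((w - p) / Phi_den N w)) \<longlongrightarrow>
      Phi_num N chi p * E p * (- 1 / (2 * of_real pi * of_real (sqrt (real N))))) (at p)"
    by (intro tendsto_mult tendsto_inverse_Phi_den assms) (auto simp: isCont_def)
  have "\<forall>\<^sub>F w in at p. Phi_N N chi w = Phi_num N chi w / Phi_den N w"
    unfolding Phi_N_eq_remove_sings[OF assms(1)]
    by (intro eventually_remove_sings_eq_at Phi_quotient_isolated_singularity assms(1))
  then have "\<forall>\<^sub>F w in at p. Phi_num N chi w * E w * ((w - p) / Phi_den N w) = Phi_N N chi w * E w * (w - p)"
    by eventually_elim simp
  from Lim_transform_eventually[OF lim this]
  show "((\<lambda>w. Phi_N N chi w * E w * (w - p)) \<longlongrightarrow>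
      - (Phi_num N chi p * E p) / (2 * of_real pi * of_real (sqrt (real N)))) (at p)" by simp
qed

section \<open>Bounds and integrability\<close>

text \<open>Compare both parts of the quotient with the larger of 1 and
  \<open>\<bar>t ^ N\<bar>\<close>: each power in the numerator is at most that, and away from the
  imaginary axis the denominator is at least a fixed fraction of it. The bound is uniform in
  \<open>Im x\<close>, so it also covers the vertical edges.\<close>

lemma Phi_N_bounded_away_from_imaginary_axis:
  assumes "N > 0"
  obtains C where "\<And>x. \<bar>Re x\<bar> \<ge> 1 \<Longrightarrow> norm (Phi_N N chi x) \<le> C"
proof -
  define s where "s = sqrt (real N)"
  have "s > 0" and s2: "s * s = real N" using assms by (auto simp: s_def)
  define C0 where "C0 = (\<Sum>n=1..N-1. norm (chi (int n)))"
  have "C0 \<ge> 0" unfolding C0_def by (intro sum_nonneg) auto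
  \<comment> \<open>The ratio of \<open>\<bar>e - 1\<bar>\<close> to \<open>max 1 e\<close> for
    \<open>e = exp (2 * pi * s * Re x)\<close>, evaluated at \<open>Re x = 1\<close> or
    \<open>Re x = -1\<close>, where it is smallest on the region considered.\<close>
  define D where "D = 1 - exp (- (2 * pi * s))"
  have "D > 0" using \<open>s > 0\<close> by (simp add: D_def)
  have num: "norm (Phi_num N chi x) \<le> C0 * max 1 (exp (2 * pi * s * Re x))" for x
  proof -
    have "norm (Phi_num N chi x) \<le> (\<Sum>n=1..N-1. norm (chi (int n)) * max 1 (exp (2 * pi * s * Re x)))"
      unfolding Phi_num_def
    proof (rule sum_norm_le)
      fix n assume n: "n \<in> {1..N-1}"
      have "norm (exp (2 * of_real pi * of_nat n * x / of_real (sqrt (real N)))) = exp (2 * pi * (real n / s) * Re x)"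
        by (simp add: s_def Re_divide_of_real)
      also have "\<dots> \<le> max 1 (exp (2 * pi * s * Re x))"
      proof (cases "Re x \<le> 0")
        case True
        then have "2 * pi * (real n / s) * Re x \<le> 0" using \<open>s > 0\<close> by (intro mult_nonneg_nonpos) auto
        then show ?thesis by (intro max.coboundedI1) simp
      next
        case False
        have "real n \<le> s * s" using n assms unfolding s2 of_nat_le_iff by auto
        then have "real n / s \<le> s" using \<open>s > 0\<close> by (simp add: divide_le_eq)
        then have "2 * pi * (real n / s) * Re x \<le> 2 * pi * s * Re x"
          using False by (intro mult_right_mono mult_left_mono) auto
        then show ?thesis by (intro max.coboundedI2) simp
      qed
      finally show "norm (chi (int n) * exp (2 * of_real pi * of_nat n * x / of_real (sqrt (real N))))
          \<le> norm (chi (int n)) * max 1 (exp (2 * pi * s * Re x))"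
        by (simp add: norm_mult mult_left_mono)
    qed
    then show ?thesis by (simp add: C0_def sum_distrib_right)
  qed
  have den: "norm (Phi_den N x) \<ge> D * max 1 (exp (2 * pi * s * Re x))" if "\<bar>Re x\<bar> \<ge> 1" for x
  proof -
    define e where "e = exp (2 * pi * s * Re x)"
    have "norm (exp (2 * of_real pi * of_real (sqrt (real N)) * x)) = e" by (simp add: e_def s_def)
    then have ge: "norm (Phi_den N x) \<ge> \<bar>e - 1\<bar>"
      unfolding Phi_den_def
      using norm_triangle_ineq3[of 1 "exp (2 * of_real pi * of_real (sqrt (real N)) * x)"] by simp
    show ?thesis
    proof (cases "Re x \<ge> 1")
      case True
      have "exp (- (2 * pi * s)) * e \<ge> 1"
        using True \<open>s > 0\<close> by (simp add: e_def flip: exp_add)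
      moreover have "e \<ge> 1" using True \<open>s > 0\<close> by (simp add: e_def)
      ultimately have "D * max 1 e \<le> \<bar>e - 1\<bar>" by (simp add: D_def algebra_simps)
      with ge show ?thesis by (simp add: e_def)
    next
      case False
      then have "Re x \<le> - 1" using that by auto
      then have "2 * pi * s * Re x \<le> 2 * pi * s * (- 1)" using \<open>s > 0\<close> by (intro mult_left_mono) auto
      then have "e \<le> exp (- (2 * pi * s))" by (simp add: e_def)
      moreover have "exp (- (2 * pi * s)) \<le> 1" using \<open>s > 0\<close> by simp
      ultimately have "e \<le> 1" "D \<le> 1 - e" unfolding D_def by linarith+
      then have "D * max 1 e \<le> \<bar>e - 1\<bar>" by simp
      with ge show ?thesis by (simp add: e_def)
    qed
  qed
  have "norm (Phi_N N chi x) \<le> C0 / D" if x: "\<bar>Re x\<bar> \<ge> 1" for x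
  proof -
    define m where "m = max 1 (exp (2 * pi * s * Re x))"
    have "m > 0" by (simp add: m_def)
    then have pos: "D * m > 0" using \<open>D > 0\<close> by simp
    have "D * m \<le> norm (Phi_den N x)" using den[OF x] by (simp add: m_def)
    then have "Phi_den N x \<noteq> 0" using pos by auto
    then have "norm (Phi_N N chi x) = norm (Phi_num N chi x) / norm (Phi_den N x)"
      using assms by (simp add: Phi_N_eq_quotient norm_divide)
    also have "\<dots> \<le> (C0 * m) / (D * m)"
      using num[of x] \<open>D * m \<le> _\<close> pos \<open>C0 \<ge> 0\<close> \<open>m > 0\<close> by (intro frac_le) (auto simp: m_def)
    also have "\<dots> = C0 / D" using \<open>m > 0\<close> by simp
    finally show ?thesis .
  qed
  then show ?thesis using that by blast
qed

lemma Phi_num_0: "Phi_num N chi 0 = (\<Sum>n=1..N-1. chi (int n))"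
  by (simp add: Phi_num_def)

lemma Phi_den_of_real_eq_0_iff:
  assumes "N > 0"
  shows "Phi_den N (of_real x) = 0 \<longleftrightarrow> x = 0"
proof
  assume "Phi_den N (of_real x) = 0"
  then obtain k :: int where "of_real x = \<i> * of_int k / complex_of_real (sqrt (real N))"
    using Phi_den_eq_0_iff[OF assms] by blast
  from arg_cong[OF this, of Re] show "x = 0" by simp
qed (simp add: Phi_den_def)

lemma Phi_N_real_continuous:
  assumes "N > 0" "(\<Sum>n=1..N-1. chi (int n)) = 0"
  shows "continuous_on A (\<lambda>x. Phi_N N chi (of_real x))"
proof -
  have "Phi_N N chi analytic_on {of_real x}" for x
    using assms by (intro Phi_N_analytic_at) (auto simp: Phi_den_of_real_eq_0_iff Phi_num_0)
  then have "isCont (\<lambda>x. Phi_N N chi (of_real x)) x" for x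
    by (rule isCont_o2[OF isCont_of_real[OF continuous_ident] analytic_at_imp_isCont])
  then show ?thesis by (simp add: continuous_at_imp_continuous_on)
qed

text \<open>On the real axis \<open>Phi_N\<close> is bounded: by compactness on
  \<open>{-1..1}\<close>, and by the preceding estimate elsewhere.\<close>

lemma integrable_Phi_N_times:
  assumes "N > 0" "(\<Sum>n=1..N-1. chi (int n)) = 0" and E: "integrable lborel E"
  shows "integrable lborel (\<lambda>x. Phi_N N chi (of_real x) * E x)"
proof -
  obtain C1 where C1: "\<And>x. \<bar>Re x\<bar> \<ge> 1 \<Longrightarrow> norm (Phi_N N chi x) \<le> C1"
    using Phi_N_bounded_away_from_imaginary_axis[OF assms(1)] by blast
  have "bounded ((\<lambda>x. Phi_N N chi (of_real x)) ` {-1..1})"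
    by (intro compact_imp_bounded compact_continuous_image Phi_N_real_continuous assms) auto
  then obtain C2 where "\<forall>y\<in>(\<lambda>x. Phi_N N chi (of_real x)) ` {-1..1}. norm y \<le> C2"
    unfolding bounded_iff by blast
  then have C2: "norm (Phi_N N chi (of_real x)) \<le> C2" if "-1 \<le> x" "x \<le> 1" for x :: real
    using that by simp
  have C: "norm (Phi_N N chi (of_real x)) \<le> max C1 C2" for x :: real
    using C1[of "of_real x"] C2[of x] by (cases "\<bar>x\<bar> \<ge> 1") (auto simp: le_max_iff_disj)
  show ?thesis
  proof (rule Bochner_Integration.integrable_bound)
    show "integrable lborel (\<lambda>x. max C1 C2 * norm (E x))"
      by (intro integrable_mult_right integrable_norm E)
    have "(\<lambda>x. Phi_N N chi (of_real x)) \<in> borel_measurable lborel"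
      unfolding measurable_lborel2 by (intro borel_measurable_continuous_onI Phi_N_real_continuous assms)
    then show "(\<lambda>x. Phi_N N chi (of_real x) * E x) \<in> borel_measurable lborel"
      by (rule borel_measurable_times[OF _ borel_measurable_integrable[OF E]])
    show "AE x in lborel. norm (Phi_N N chi (of_real x) * E x) \<le> norm (max C1 C2 * norm (E x))"
    proof (rule AE_I2)
      fix x :: real
      have "norm (Phi_N N chi (of_real x) * E x) \<le> max C1 C2 * norm (E x)"
        unfolding norm_mult by (intro mult_right_mono C) auto
      then show "norm (Phi_N N chi (of_real x) * E x) \<le> norm (max C1 C2 * norm (E x))" by simp
    qed
  qed
qed

lemma h_N_integrable:
  assumes "N > 0" "(\<Sum>n=1..N-1. chi (int n)) = 0" "Im \<tau> > 0"
  shows "integrable lborel (\<lambda>x. Phi_N N chi (of_real x) *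
    exp (of_real pi * \<i> * \<tau> * (of_real x)\<^sup>2 - 2 * of_real pi * z * of_real x))"
  by (rule integrable_Phi_N_times[OF assms(1,2) gaussian_integral_upper_half_plane(1)[OF assms(3)]])

section \<open>Translation formulas\<close>

text \<open>Stated for any coefficients with vanishing sum. The index \<open>N - n\<close> is the
  one the cancellation produces; multiplicativity of the character later turns it into
  \<open>n\<close>.\<close>

lemma h_N_real_translation:
  fixes \<tau> z :: complex
  assumes "N > 0" and sum0: "(\<Sum>n=1..N-1. chi (int n)) = 0" and \<tau>: "Im \<tau> > 0"
  shows "h_N N z \<tau> chi - h_N N (z + of_real (sqrt (real N))) \<tau> chi =
    - (\<Sum>n=1..N-1. chi (int n) * (exp (\<i> * of_real pi *
        (z + of_nat (N - n) / of_real (sqrt (real N)))\<^sup>2 / \<tau>) / csqrt (- \<i> * \<tau>)))"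
proof -
  define s where "s = complex_of_real (sqrt (real N))"
  have "s \<noteq> 0" and s2: "s * s = of_nat N"
    using assms of_real_sqrt_mult_self[of N] by (auto simp: s_def)
  define E where "E w x = exp (of_real pi * \<i> * \<tau> * (of_real x)\<^sup>2 - 2 * of_real pi * w * of_real x)"
    for w :: complex and x :: real
  have E_int: "integrable lborel (E w)" for w
    unfolding E_def by (rule gaussian_integral_upper_half_plane(1)[OF \<tau>])
  have pointwise: "Phi_N N chi (of_real x) * E z x - Phi_N N chi (of_real x) * E (z + s) x
      = - (\<Sum>n=1..N-1. chi (int n) * E (z + of_nat (N - n) / s) x)" for x :: real
  proof (cases "x = 0")
    case True
    \<comment> \<open>At the removable singularity both exponentials on the left are 1, and the
      right side is minus the coefficient sum.\<close>
    then show ?thesis using sum0 by (simp add: E_def)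
  next
    case False
    \<comment> \<open>This \<open>t\<close> is the \<open>N\<close>-th power of the argument of
      \<open>phi_N\<close>. Since \<open>(1 - 1 / t) / (1 - t) = - 1 / t\<close>, the numerator over
      \<open>t\<close> remains, and \<open>s - n / s = (N - n) / s\<close> identifies its
      terms.\<close>
    define t where "t = exp (2 * of_real pi * s * of_real x)"
    have den: "Phi_den N (of_real x) = 1 - t" by (simp add: Phi_den_def t_def s_def)
    with False assms(1) have "t \<noteq> 1" using Phi_den_of_real_eq_0_iff[of N x] by auto
    have "t \<noteq> 0" by (simp add: t_def)
    have Ezs: "E (z + s) x = E z x / t"
      by (simp add: E_def t_def exp_diff[symmetric] algebra_simps)
    have En: "E (z + of_nat (N - n) / s) x = exp (2 * of_real pi * of_nat n * of_real x / s) * E z x / t"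
      if "n \<in> {1..N-1}" for n
    proof -
      have nz: "complex_of_nat (N - n) / s = s - of_nat n / s"
      proof -
        have "n \<le> N" using that by auto
        then have "complex_of_nat (N - n) = s * s - of_nat n" by (simp add: of_nat_diff s2)
        then show ?thesis using \<open>s \<noteq> 0\<close> by (simp add: field_simps)
      qed
      show ?thesis
        unfolding E_def t_def nz by (simp add: exp_diff[symmetric] exp_add[symmetric] algebra_simps)
    qed
    have sum_eq: "(\<Sum>n=1..N-1. chi (int n) * E (z + of_nat (N - n) / s) x) = Phi_num N chi (of_real x) * E z x / t"
      unfolding Phi_num_def sum_distrib_right sum_divide_distrib
      by (intro sum.cong refl) (simp only: En s_def[symmetric] times_divide_eq_right mult.assoc)
    have Phi_eq: "Phi_N N chi (of_real x) = Phi_num N chi (of_real x) / (1 - t)"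
      using Phi_N_eq_quotient[OF assms(1), of "of_real x" chi] \<open>t \<noteq> 1\<close> by (simp add: den)
    show ?thesis
      unfolding sum_eq Phi_eq Ezs using \<open>t \<noteq> 1\<close> \<open>t \<noteq> 0\<close> by (simp add: divide_simps) (simp add: algebra_simps)
  qed
  have "h_N N z \<tau> chi - h_N N (z + s) \<tau> chi
      = (LINT x|lborel. Phi_N N chi (of_real x) * E z x - Phi_N N chi (of_real x) * E (z + s) x)"
    unfolding h_N_def E_def using assms by (intro Bochner_Integration.integral_diff[symmetric] h_N_integrable)
  also have "\<dots> = (LINT x|lborel. - (\<Sum>n=1..N-1. chi (int n) * E (z + of_nat (N - n) / s) x))"
    unfolding pointwise ..
  also have "\<dots> = - (\<Sum>n=1..N-1. chi (int n) * (LINT x|lborel. E (z + of_nat (N - n) / s) x))"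
    using E_int by (simp add: Bochner_Integration.integral_sum)
  also have "(\<lambda>n. LINT x|lborel. E (z + of_nat (N - n) / s) x)
      = (\<lambda>n. exp (\<i> * of_real pi * (z + of_nat (N - n) / s)\<^sup>2 / \<tau>) / csqrt (- \<i> * \<tau>))"
    unfolding E_def by (rule ext, rule gaussian_integral_upper_half_plane(2)[OF \<tau>])
  finally show ?thesis by (simp add: s_def)
qed

text \<open>The zeros of the denominator are spaced by \<open>1 / s\<close>, so a margin of that
  width stops just short of \<open>k = -1\<close> and \<open>k = N + 1\<close>. Of the remaining
  indices, \<open>k = 0\<close> and \<open>k = N\<close> are removable.\<close>

lemma Phi_N_holomorphic_on_strip:
  assumes "N > 0" and sum0: "(\<Sum>n=1..N-1. chi (int n)) = 0"
  defines "s \<equiv> sqrt (real N)"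
  shows "Phi_N N chi holomorphic_on {x. - (1 / s) < Im x \<and> Im x < s + 1 / s}
    - (\<lambda>k. \<i> * of_nat k / of_real s) ` {1..N-1}"
proof (rule analytic_imp_holomorphic, subst analytic_on_analytic_at, safe)
  fix p assume lo: "- (1 / s) < Im p" and hi: "Im p < s + 1 / s"
    and p: "p \<notin> (\<lambda>k. \<i> * of_nat k / of_real s) ` {1..N-1}"
  have "s > 0" and s2: "s * s = real N" using assms by (auto simp: s_def)
  show "Phi_N N chi analytic_on {p}"
  proof (rule Phi_N_analytic_at[OF assms(1)])
    assume "Phi_den N p = 0"
    then obtain k :: int where k: "p = \<i> * of_int k / of_real s"
      using Phi_den_eq_0_iff[OF assms(1)] by (auto simp: s_def)
    then have Im: "Im p = of_int k / s" by simp
    have "real_of_int k > - 1" using lo \<open>s > 0\<close> by (simp add: Im field_simps)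
    moreover have "real_of_int k < real N + 1" using hi \<open>s > 0\<close> by (simp add: Im field_simps s2)
    ultimately have "0 \<le> k" "k \<le> int N" by linarith+
    then obtain m where m: "k = int m" "m \<le> N" by (metis nat_0_le nat_le_iff)
    have "m \<notin> {1..N-1}" using p k m by auto
    then consider "m = 0" | "m = N" using m(2) by fastforce
    then show "Phi_num N chi p = 0"
    proof cases
      case 1
      then show ?thesis using k m sum0 by (simp add: Phi_num_0)
    next
      case 2
      \<comment> \<open>\<open>\<i> * N / s\<close> is \<open>\<i> * s\<close>, one period above 0,
        where the numerator vanishes.\<close>
      have "complex_of_nat N = of_real s * of_real s" unfolding s_def by (rule of_real_sqrt_mult_self[symmetric])
      then have "p = 0 + \<i> * of_real (sqrt (real N))"
        using k m 2 \<open>s > 0\<close> by (simp add: s_def[symmetric])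
      then have "Phi_num N chi p = Phi_num N chi 0" using Phi_num_shift[of N chi 0] by simp
      then show ?thesis using sum0 by (simp add: Phi_num_0)
    qed
  qed
qed

text \<open>Again for any coefficients with vanishing sum: the numerator values at the poles stay
  unevaluated until primitivity is available.\<close>

lemma h_N_imaginary_translation:
  fixes \<tau> z :: complex
  assumes "N > 0" and sum0: "(\<Sum>n=1..N-1. chi (int n)) = 0" and \<tau>: "Im \<tau> > 0"
  shows "h_N N z \<tau> chi - exp (- \<i> * of_real pi * of_nat N * \<tau> - 2 * \<i> * of_real pi * of_real (sqrt (real N)) * z) *
      h_N N (z + of_real (sqrt (real N)) * \<tau>) \<tau> chi
    = 1 / (\<i> * of_real (sqrt (real N))) * (\<Sum>k=1..N-1. Phi_num N chi (\<i> * of_nat k / of_real (sqrt (real N))) *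
        exp (- \<i> * of_real pi * (of_nat k)\<^sup>2 * \<tau> / of_nat N
             - 2 * \<i> * of_real pi * of_nat k * z / of_real (sqrt (real N))))"
proof -
  define r where "r = sqrt (real N)"
  define s where "s = complex_of_real r"
  have "r > 0" and "s \<noteq> 0" and s2: "s * s = of_nat N"
    using assms of_real_sqrt_mult_self[of N] by (auto simp: s_def r_def)
  define E where "E w x = exp (of_real pi * \<i> * \<tau> * x\<^sup>2 - 2 * of_real pi * w * x)" for w x :: complex
  define F where "F x = Phi_N N chi x * E z x" for x
  define c where "c = exp (- \<i> * of_real pi * of_nat N * \<tau> - 2 * \<i> * of_real pi * s * z)"
  define pole where "pole k = \<i> * of_nat k / s" for k :: nat
  define S where "S = {x. - (1 / r) < Im x \<and> Im x < r + 1 / r}"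
  define pts where "pts = pole ` {1..N-1}"
  have E_hol: "E w holomorphic_on A" for w A unfolding E_def by (intro holomorphic_intros)
  have Phi_hol: "Phi_N N chi holomorphic_on S - pts"
    using Phi_N_holomorphic_on_strip[OF assms(1) sum0]
    by (simp add: S_def pts_def pole_def[abs_def] s_def r_def)
  have int: "integrable lborel (\<lambda>x. Phi_N N chi (of_real x) * E w (of_real x))" for w
    unfolding E_def by (intro h_N_integrable assms)
  \<comment> \<open>Expanding \<open>(x + \<i> * s)\<^sup>2\<close> gives the constant factor
    \<open>c\<close> and a cross term that changes \<open>z\<close> into
    \<open>z + s * \<tau>\<close>; \<open>Phi_N\<close> itself is periodic.\<close>
  have shift: "F (of_real x + \<i> * of_real r) = c * (Phi_N N chi (of_real x) * E (z + s * \<tau>) (of_real x))" for x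
  proof -
    have "of_real pi * \<i> * \<tau> * (of_real x + \<i> * s)\<^sup>2 - 2 * of_real pi * z * (of_real x + \<i> * s)
      = of_real pi * \<i> * \<tau> * ((of_real x)\<^sup>2 + 2 * \<i> * s * of_real x - s * s) - 2 * of_real pi * z * (of_real x + \<i> * s)"
      by (simp add: power2_eq_square algebra_simps)
    also have "\<dots> = (- \<i> * of_real pi * of_nat N * \<tau> - 2 * \<i> * of_real pi * s * z)
        + (of_real pi * \<i> * \<tau> * (of_real x)\<^sup>2 - 2 * of_real pi * (z + s * \<tau>) * of_real x)"
      unfolding s2 by (simp add: algebra_simps)
    finally have "E z (of_real x + \<i> * of_real r) = c * E (z + s * \<tau>) (of_real x)"
      by (simp add: E_def c_def exp_add s_def)
    moreover have "Phi_N N chi (of_real x + \<i> * of_real r) = Phi_N N chi (of_real x)"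
      unfolding r_def by (rule Phi_N_shift[OF assms(1)])
    ultimately show ?thesis by (simp add: F_def)
  qed
  obtain C where C: "\<And>x. \<bar>Re x\<bar> \<ge> 1 \<Longrightarrow> norm (Phi_N N chi x) \<le> C"
    using Phi_N_bounded_away_from_imaginary_axis[OF assms(1)] by blast
  have "norm (Phi_N N chi 1) \<le> C" by (rule C) simp
  then have "C \<ge> 0" using norm_ge_zero[of "Phi_N N chi 1"] by linarith
  have "Re (- of_real pi * \<i> * \<tau>) > 0" using \<tau> by simp
  then obtain K d where K: "K \<ge> 0" "d > 0"
    "\<And>x. 0 \<le> Im x \<Longrightarrow> Im x \<le> r \<Longrightarrow>
      norm (exp (- (- of_real pi * \<i> * \<tau>) * x\<^sup>2 + (- 2 * of_real pi * z) * x)) \<le> K * exp (- d * (Re x)\<^sup>2)"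
    using norm_exp_quadratic_strip_bound[of "- of_real pi * \<i> * \<tau>" r "- 2 * of_real pi * z"] by blast
  have "(LINT x|lborel. F (of_real x)) - (LINT x|lborel. F (of_real x + \<i> * of_real r))
    = 2 * of_real pi * \<i> * (\<Sum>p\<in>pts. residue F p)"
  proof (rule horizontal_line_integral_shift[where \<epsilon> = "1 / r" and L = 1 and B = "\<lambda>x. C * K * exp (- d * x\<^sup>2)"])
    show "pts \<subseteq> {z. 0 < Im z \<and> Im z < r}"
    proof safe
      fix p assume "p \<in> pts"
      then obtain k where k: "1 \<le> k" "k \<le> N - 1" "p = pole k" by (auto simp: pts_def)
      have "real k < real N" using k assms(1) by linarith
      then have "real k < r * r" by (simp add: r_def)
      then show "0 < Im p" "Im p < r" using k(1) \<open>r > 0\<close> by (simp_all add: k(3) pole_def s_def field_simps)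
    qed
    show "F holomorphic_on {z. - (1 / r) < Im z \<and> Im z < r + 1 / r} - pts"
      using Phi_hol unfolding F_def S_def by (intro holomorphic_on_mult E_hol)
    show "integrable lborel (\<lambda>x. F (of_real x))" unfolding F_def by (rule int)
    show "integrable lborel (\<lambda>x. F (of_real x + \<i> * of_real r))"
      unfolding shift by (intro integrable_mult_right int)
    show "norm (F x) \<le> C * K * exp (- d * \<bar>Re x\<bar>\<^sup>2)" if "\<bar>Re x\<bar> \<ge> 1" "0 \<le> Im x" "Im x \<le> r" for x
    proof -
      have "norm (E z x) \<le> K * exp (- d * (Re x)\<^sup>2)"
        using K(3)[OF that(2,3)] by (simp add: E_def)
      then have "norm (F x) \<le> C * (K * exp (- d * (Re x)\<^sup>2))"
        unfolding F_def norm_mult using C[OF that(1)] \<open>C \<ge> 0\<close> by (intro mult_mono) auto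
      then show ?thesis by (simp add: mult.assoc)
    qed
    show "((\<lambda>x. C * K * exp (- d * x\<^sup>2)) \<longlongrightarrow> 0) at_top" by (rule exp_neg_square_tendsto_0[OF K(2)])
  qed (use \<open>r > 0\<close> in \<open>auto simp: pts_def\<close>)
  also have "(LINT x|lborel. F (of_real x)) = h_N N z \<tau> chi"
    by (simp add: F_def E_def h_N_def)
  also have "(LINT x|lborel. F (of_real x + \<i> * of_real r)) = c * h_N N (z + s * \<tau>) \<tau> chi"
    unfolding shift by (simp add: E_def h_N_def)
  also have "(\<Sum>p\<in>pts. residue F p) = (\<Sum>k=1..N-1. residue F (pole k))"
    unfolding pts_def by (subst sum.reindex) (use \<open>s \<noteq> 0\<close> in \<open>auto simp: inj_on_def pole_def\<close>)
  also have "(\<Sum>k=1..N-1. residue F (pole k))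
      = (\<Sum>k=1..N-1. - (Phi_num N chi (pole k) * E z (pole k)) / (2 * of_real pi * s))"
  proof (rule sum.cong[OF refl])
    fix k assume k: "k \<in> {1..N-1}"
    have S: "open S"
    proof -
      have "S = {x. Im x > - (1 / r)} \<inter> {x. Im x < r + 1 / r}" by (auto simp: S_def)
      then show ?thesis by (simp add: open_Int open_halfspace_Im_gt open_halfspace_Im_lt)
    qed
    have "pole k \<in> S"
    proof -
      have "real k < real N" using k by auto
      then have "real k < r * r" by (simp add: r_def)
      then have "0 \<le> Im (pole k)" "Im (pole k) < r" using \<open>r > 0\<close> by (simp_all add: pole_def s_def field_simps)
      moreover have "1 / r > 0" using \<open>r > 0\<close> by simp
      ultimately show ?thesis unfolding S_def mem_Collect_eq by linarith
    qed
    have "residue (\<lambda>x. Phi_N N chi x * E z x) (pole k)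
        = - (Phi_num N chi (pole k) * E z (pole k)) / (2 * of_real pi * of_real (sqrt (real N)))"
    \<comment> \<open>Removing the other poles from the strip leaves an open set in which
      \<open>pole k\<close> is the only exceptional point.\<close>
    proof (rule residue_Phi_N_times[OF assms(1) _ E_hol, where S = "S - (pts - {pole k})"])
      show "Phi_den N (pole k) = 0"
        unfolding Phi_den_eq_0_iff[OF assms(1)] by (auto simp: pole_def s_def r_def intro!: exI[of _ "int k"])
      show "open (S - (pts - {pole k}))"
        using S by (intro open_Diff finite_imp_closed) (auto simp: pts_def)
      show "pole k \<in> S - (pts - {pole k})" using \<open>pole k \<in> S\<close> by auto
      show "Phi_N N chi holomorphic_on S - (pts - {pole k}) - {pole k}"
        by (rule holomorphic_on_subset[OF Phi_hol]) auto
    qed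
    then show "residue F (pole k) = - (Phi_num N chi (pole k) * E z (pole k)) / (2 * of_real pi * s)"
      by (simp add: F_def[abs_def] s_def r_def)
  qed
  \<comment> \<open>The factors combine to \<open>- \<i> / s = 1 / (\<i> * s)\<close>.\<close>
  also have "2 * of_real pi * \<i> * \<dots> = 1 / (\<i> * s) * (\<Sum>k=1..N-1. Phi_num N chi (pole k) * E z (pole k))"
    using \<open>s \<noteq> 0\<close> by (simp add: sum_negf sum_divide_distrib[symmetric] field_simps)
  also have "(\<Sum>k=1..N-1. Phi_num N chi (pole k) * E z (pole k)) = (\<Sum>k=1..N-1. Phi_num N chi (pole k) *
        exp (- \<i> * of_real pi * (of_nat k)\<^sup>2 * \<tau> / of_nat N - 2 * \<i> * of_real pi * of_nat k * z / s))"
  proof (intro sum.cong refl arg_cong2[of _ _ _ _ "(*)"])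
    fix k
    have "(pole k)\<^sup>2 = - ((of_nat k)\<^sup>2 / of_nat N)"
      by (simp add: pole_def power_divide power_mult_distrib power2_eq_square[of s] s2)
    then have "of_real pi * \<i> * \<tau> * (pole k)\<^sup>2 = - \<i> * of_real pi * (of_nat k)\<^sup>2 * \<tau> / of_nat N"
      by simp
    moreover have "2 * of_real pi * z * pole k = 2 * \<i> * of_real pi * of_nat k * z / s"
      by (simp add: pole_def)
    ultimately show "E z (pole k) = exp (- \<i> * of_real pi * (of_nat k)\<^sup>2 * \<tau> / of_nat N
        - 2 * \<i> * of_real pi * of_nat k * z / s)"
      unfolding E_def by (simp only:)
  qed
  finally show ?thesis by (simp add: c_def pole_def s_def r_def)
qed

theorem theorem1p3:
  fixes N :: nat and chi :: "int \<Rightarrow> complex" and \<tau> z :: complex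
  assumes "N \<ge> 2"
    and "dirichlet_character N chi"
    and "\<not> principal_character N chi"
    and "Im \<tau> > 0"
  shows "h_N N z \<tau> chi - h_N N (z + of_real (sqrt (real N))) \<tau> chi =
           - (chi (-1) / csqrt (- \<i> * \<tau>)) *
             (\<Sum>k=1..N-1. chi (int k) *
                exp (\<i> * of_real pi * (z + of_nat k / of_real (sqrt (real N)))\<^sup>2 / \<tau>))
         \<and> (N \<ge> 3 \<and> primitive_character N chi \<longrightarrow>
           h_N N z \<tau> chi -
             exp (- \<i> * of_real pi * of_nat N * \<tau> - 2 * \<i> * of_real pi * of_real (sqrt (real N)) * z) *
             h_N N (z + of_real (sqrt (real N)) * \<tau>) \<tau> chi =
           gauss_sum N chi / (\<i> * of_real (sqrt (real N))) *
             (\<Sum>n=1..N-1. cnj (chi (int n)) *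
                exp (- \<i> * of_real pi * (of_nat n)\<^sup>2 * \<tau> / of_nat N
                     - 2 * \<i> * of_real pi * of_nat n * z / of_real (sqrt (real N)))))"
proof (intro conjI impI)
  have N: "N > 0" using assms(1) by simp
  have sum0: "(\<Sum>n=1..N-1. chi (int n)) = 0"
    by (rule nonprincipal_character_sum_eq_0[OF assms(2,1,3)])
  define G where "G k = exp (\<i> * of_real pi * (z + of_nat k / of_real (sqrt (real N)))\<^sup>2 / \<tau>)" for k :: nat
  \<comment> \<open>\<open>N - k\<close> is congruent to \<open>- k\<close>; this is the source of
    \<open>chi (-1)\<close> once the sum is reversed.\<close>
  have reflect: "chi (int (N - k)) = chi (- 1) * chi (int k)" if "k \<in> {1..N-1}" for k
  proof -
    have "int (N - k) = - 1 * int k + int N" using that by auto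
    then show ?thesis
      using dirichlet_characterD(2)[OF assms(2), of "- 1 * int k"] dirichlet_characterD(3)[OF assms(2), of "-1" "int k"]
      by simp
  qed
  have "h_N N z \<tau> chi - h_N N (z + of_real (sqrt (real N))) \<tau> chi
      = - (\<Sum>n=1..N-1. chi (int n) * (G (N - n) / csqrt (- \<i> * \<tau>)))"
    unfolding G_def by (rule h_N_real_translation[OF N sum0 assms(4)])
  also have "(\<Sum>n=1..N-1. chi (int n) * (G (N - n) / csqrt (- \<i> * \<tau>)))
      = (\<Sum>n=1..N-1. chi (int (N - n)) * (G n / csqrt (- \<i> * \<tau>)))"
    by (subst sum.atLeastAtMost_rev, intro sum.cong) (use N in auto)
  also have "\<dots> = (\<Sum>n=1..N-1. chi (- 1) / csqrt (- \<i> * \<tau>) * (chi (int n) * G n))"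
    by (intro sum.cong refl) (simp add: reflect)
  also have "- \<dots> = - (chi (-1) / csqrt (- \<i> * \<tau>)) * (\<Sum>k=1..N-1. chi (int k) * G k)"
    unfolding sum_distrib_left[symmetric] by (rule mult_minus_left[symmetric])
  finally show "h_N N z \<tau> chi - h_N N (z + of_real (sqrt (real N))) \<tau> chi =
           - (chi (-1) / csqrt (- \<i> * \<tau>)) *
             (\<Sum>k=1..N-1. chi (int k) *
                exp (\<i> * of_real pi * (z + of_nat k / of_real (sqrt (real N)))\<^sup>2 / \<tau>))"
    by (simp only: G_def)
  assume prim: "N \<ge> 3 \<and> primitive_character N chi"
  have "Phi_num N chi (\<i> * of_nat k / of_real (sqrt (real N))) = cnj (chi (int k)) * gauss_sum N chi" for k
  proof -
    \<comment> \<open>The two roots multiply to \<open>N\<close>, so the numerator at a pole is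
      exactly the Gauss sum twisted by \<open>k\<close>.\<close>
    have "2 * of_real pi * of_nat n * (\<i> * of_nat k / of_real (sqrt (real N))) / of_real (sqrt (real N))
        = 2 * of_real pi * \<i> * of_nat k * of_nat n / of_nat N" for n
      unfolding of_real_sqrt_mult_self[symmetric, of N] by simp
    then show ?thesis
      using primitive_character_twisted_gauss_sum[of N chi k] prim by (simp add: Phi_num_def)
  qed
  then have sum_eq: "(\<Sum>k=1..N-1. Phi_num N chi (\<i> * of_nat k / of_real (sqrt (real N))) * X k)
      = gauss_sum N chi * (\<Sum>k=1..N-1. cnj (chi (int k)) * X k)" for X
    unfolding sum_distrib_left by (intro sum.cong refl) simp
  show "h_N N z \<tau> chi -
             exp (- \<i> * of_real pi * of_nat N * \<tau> - 2 * \<i> * of_real pi * of_real (sqrt (real N)) * z) *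
             h_N N (z + of_real (sqrt (real N)) * \<tau>) \<tau> chi =
           gauss_sum N chi / (\<i> * of_real (sqrt (real N))) *
             (\<Sum>n=1..N-1. cnj (chi (int n)) *
                exp (- \<i> * of_real pi * (of_nat n)\<^sup>2 * \<tau> / of_nat N
                     - 2 * \<i> * of_real pi * of_nat n * z / of_real (sqrt (real N))))"
    unfolding h_N_imaginary_translation[OF N sum0 assms(4)] sum_eq by simp
qed

end
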